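(* Let $E:\mathcal{H}\to\mathbb{R}$ be of class $C^2$ and let $P_*\in\mathcal{M}_N$ be a nondegenerate local minimizer of $E$ on $\mathcal{M}_N$, i.e. there exists $\eta>0$ such that $E(P)\ge E(P_* )+\eta\|P-P_*\|_{\rm F}^2$ for all $P\in\mathcal{M}_N$ in a neighborhood of $P_*$. Let $R:\mathcal{H}\to\mathcal{H}$ be of class $C^2$ such that for all $P\in\mathcal{M}_N$ and all $X\in\mathcal{H}$ small enough, $R(P+X)\in\mathcal{M}_N$ and $R(P+X)=P+\Pi_P(X)+O(X^2)$. Assume that $P_*$ satisfies the strong Aufbau principle: $\Phi(P_* )=P_*$ and $\nu:=\varepsilon_{N+1}-\varepsilon_N>0$, where $\varepsilon_1\le\cdots\le\varepsilon_{N_b}$ are the eigenvalues of $H_*$. Then for $\beta>0$ small enough and $P^0\in\mathcal{M}_N$ close enough to $P_*$, the iterates \[ P^{k+1}:=R\big(P^k+\beta\,\Pi_{P^k}(\Phi(P^k)-P^k)\big) \] are well defined and converge linearly to $P_*$ with asymptotic rate $r(1-\beta J_{\rm SCF})<1$, where $J_{\rm SCF}:=1+\Omega_*^{-1}K_*$; that is, for every $\theta>0$ there is $C_\theta>0$ such that $\|P^k-P_*\|_{\rm F}\le C_\theta\,(r(1-\beta J_{\rm SCF})+\theta)^k\,\|P^0-P_*\|_{\rm F}$ for all $k$, for all such $P^0$.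
   Context: $\mathcal{H}$ is the space of real symmetric $N_b\times N_b$ matrices with the Frobenius inner product $\mathrm{Tr}(AB)$. For $1\le N\le N_b$, $\mathcal{M}_N:=\{P\in\mathcal{H}\mid P^2=P,\ \mathrm{Tr}(P)=N\}$. For $P\in\mathcal{M}_N$, $\Pi_P(X)=PX(1-P)+(1-P)XP$ is the orthogonal projection onto the tangent space $T_P\mathcal{M}_N=\{X\in\mathcal{H}\mid PXP=(1-P)X(1-P)=0\}$. Write $H(P):=\nabla E(P)$, $H_*:=H(P_* )$, $K_*:=\Pi_{P_*}\nabla^2E(P_* )\Pi_{P_*}$, and $\Omega_*:T_{P_*}\mathcal{M}_N\to T_{P_*}\mathcal{M}_N$, $\Omega_*X:=-[P_*,[H_*,X]]$ (equivalently $P_*X(1-P_* )H_*-H_*P_*X(1-P_* )$ plus its transpose); under the stated gap assumption $\Omega_*$ is invertible on $T_{P_*}\mathcal{M}_N$. For a symmetric matrix $P$ such that the $N$-th and $(N+1)$-st smallest eigenvalues of $H(P)$ are distinct, $\Phi(P):=\sum_{i=1}^N\phi_i\phi_i^*$ where $\phi_1,\dots,\phi_N$ are orthonormal eigenvectors of $H(P)$ associated with its $N$ lowest eigenvalues. $J_{\rm SCF}$ acts on $T_{P_*}\mathcal{M}_N$ and $r(\cdot)$ is the spectral radius. *)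

theory Defs
  imports "HOL-Analysis.Analysis"
begin

text \<open>Matrices are elements of real^'n^'n; N_b = CARD('n). The Euclidean inner product
and norm on real^'n^'n are the Frobenius ones (on symmetric matrices equal to Tr(AB)).\<close>

definition symm :: "real^'n^'n \<Rightarrow> bool" where
  "symm A \<longleftrightarrow> transpose A = A"

definition sym_part :: "real^'n^'n \<Rightarrow> real^'n^'n" where
  "sym_part A = (1/2) *\<^sub>R (A + transpose A)"

definition MN :: "nat \<Rightarrow> (real^'n^'n) set" where
  "MN N = {P. symm P \<and> P ** P = P \<and> trace P = real N}"

definition PiP :: "real^'n^'n \<Rightarrow> real^'n^'n \<Rightarrow> real^'n^'n" where
  "PiP P X = P ** X ** (mat 1 - P) + (mat 1 - P) ** X ** P"

definition tangent :: "real^'n^'n \<Rightarrow> (real^'n^'n) set" where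
  "tangent P = {X. symm X \<and> P ** X ** P = 0 \<and> (mat 1 - P) ** X ** (mat 1 - P) = 0}"

definition C2 :: "('a::euclidean_space \<Rightarrow> 'b::real_normed_vector) \<Rightarrow> bool" where
  "C2 f \<longleftrightarrow> (\<exists>f' f''.
      (\<forall>x. (f has_derivative blinfun_apply (f' x)) (at x)) \<and>
      (\<forall>x. (f' has_derivative blinfun_apply (f'' x)) (at x)) \<and>
      continuous_on UNIV f'')"

text \<open>Full gradient, gradient on the space H of symmetric matrices, and Hessian on H.\<close>
definition grad :: "(real^'n^'n \<Rightarrow> real) \<Rightarrow> real^'n^'n \<Rightarrow> real^'n^'n" where
  "grad E P = (SOME g. GDERIV E P :> g)"

definition Hgrad :: "(real^'n^'n \<Rightarrow> real) \<Rightarrow> real^'n^'n \<Rightarrow> real^'n^'n" where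
  "Hgrad E P = sym_part (grad E P)"

definition Hess :: "(real^'n^'n \<Rightarrow> real) \<Rightarrow> real^'n^'n \<Rightarrow> real^'n^'n \<Rightarrow> real^'n^'n" where
  "Hess E P X = sym_part (frechet_derivative (grad E) (at P) X)"

text \<open>Orthonormal eigenbasis with eigenvalues sorted nondecreasingly
 (indices 0..N_b-1, so lam (N-1) is the N-th smallest eigenvalue).\<close>
definition eigdec :: "real^'n^'n \<Rightarrow> (nat \<Rightarrow> real^'n) \<Rightarrow> (nat \<Rightarrow> real) \<Rightarrow> bool" where
  "eigdec A phi lam \<longleftrightarrow>
     (\<forall>i<CARD('n). \<forall>j<CARD('n). phi i \<bullet> phi j = (if i = j then 1 else 0)) \<and>
     (\<forall>i<CARD('n). A *v phi i = lam i *\<^sub>R phi i) \<and>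
     (\<forall>i j. i \<le> j \<and> j < CARD('n) \<longrightarrow> lam i \<le> lam j)"

definition outer :: "real^'n \<Rightarrow> real^'n \<Rightarrow> real^'n^'n" where
  "outer u v = (\<chi> i j. u $ i * v $ j)"

definition aufbau_gap :: "real^'n^'n \<Rightarrow> nat \<Rightarrow> bool" where
  "aufbau_gap A N \<longleftrightarrow> 1 \<le> N \<and> N < CARD('n) \<and>
     (\<exists>phi lam. eigdec A phi lam \<and> lam (N - 1) < lam N)"

text \<open>Projector onto the N lowest eigenvectors of A (well defined when aufbau_gap A N).\<close>
definition PhiA :: "real^'n^'n \<Rightarrow> nat \<Rightarrow> real^'n^'n" where
  "PhiA A N = (SOME Q. \<exists>phi lam. eigdec A phi lam \<and> Q = (\<Sum>i<N. outer (phi i) (phi i)))"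

definition Phi :: "(real^'n^'n \<Rightarrow> real) \<Rightarrow> nat \<Rightarrow> real^'n^'n \<Rightarrow> real^'n^'n" where
  "Phi E N P = PhiA (Hgrad E P) N"

definition comm :: "real^'n^'n \<Rightarrow> real^'n^'n \<Rightarrow> real^'n^'n" where
  "comm A B = A ** B - B ** A"

definition Omega :: "real^'n^'n \<Rightarrow> real^'n^'n \<Rightarrow> real^'n^'n \<Rightarrow> real^'n^'n" where
  "Omega P H X = - comm P (comm H X)"

definition Omega_inv :: "real^'n^'n \<Rightarrow> real^'n^'n \<Rightarrow> real^'n^'n \<Rightarrow> real^'n^'n" where
  "Omega_inv P H Y = (THE X. X \<in> tangent P \<and> Omega P H X = Y)"

definition Kop :: "(real^'n^'n \<Rightarrow> real) \<Rightarrow> real^'n^'n \<Rightarrow> real^'n^'n \<Rightarrow> real^'n^'n" where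
  "Kop E P X = PiP P (Hess E P (PiP P X))"

definition J_SCF :: "(real^'n^'n \<Rightarrow> real) \<Rightarrow> real^'n^'n \<Rightarrow> real^'n^'n \<Rightarrow> real^'n^'n" where
  "J_SCF E P X = X + Omega_inv P (Hgrad E P) (Kop E P X)"

text \<open>Complex eigenvalues of a real linear operator L on a subspace T
 (i.e. eigenvalues of its complexification) and its spectral radius.\<close>
definition op_eigenvalue :: "'a::real_vector set \<Rightarrow> ('a \<Rightarrow> 'a) \<Rightarrow> complex \<Rightarrow> bool" where
  "op_eigenvalue T L z \<longleftrightarrow> (\<exists>x y. x \<in> T \<and> y \<in> T \<and> (x \<noteq> 0 \<or> y \<noteq> 0) \<and>
      L x = Re z *\<^sub>R x - Im z *\<^sub>R y \<and> L y = Im z *\<^sub>R x + Re z *\<^sub>R y)"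

definition op_spectral_radius :: "'a::real_vector set \<Rightarrow> ('a \<Rightarrow> 'a) \<Rightarrow> real" where
  "op_spectral_radius T L = Max {cmod z | z. op_eigenvalue T L z}"

primrec iter :: "(real^'n^'n \<Rightarrow> real^'n^'n) \<Rightarrow> (real^'n^'n \<Rightarrow> real) \<Rightarrow> nat \<Rightarrow> real
     \<Rightarrow> real^'n^'n \<Rightarrow> nat \<Rightarrow> real^'n^'n" where
  "iter R E N beta P0 0 = P0"
| "iter R E N beta P0 (Suc k) =
     (let P = iter R E N beta P0 k in R (P + beta *\<^sub>R PiP P (Phi E N P - P)))"

end

theory Submission
  imports Defs
begin

text \<open>
  For \<open>P = Ps + D\<close> in \<open>MN N\<close> the component of \<open>D\<close> normal to the manifold at \<open>Ps\<close> is quadratic in \<open>D\<close>,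
  and for \<open>H\<close> commuting with \<open>Ps\<close> the pairing \<open>inner H D\<close> is exactly the quadratic form that equals
  half of \<open>Omega\<close> on tangent vectors. Feeding curves supplied by the retraction into the eigenvalue
  gap inequality and into the second-order growth of \<open>E\<close> therefore gives \<open>Omega \<ge> nu\<close> and
  \<open>Omega + K \<ge> eta\<close> on the tangent space. Hence \<open>J = Omega\<^sup>-\<^sup>1 (Omega + K)\<close> is self-adjoint with
  positive eigenvalues for the inner product \<open>\<langle>X, Omega Y\<rangle>\<close>, so for small \<open>beta\<close> the operator
  \<open>1 - beta J\<close> has spectral radius below 1, and this radius is its norm for that inner product.

  The variational characterization of spectral projectors makes \<open>Phi\<close> Lipschitz at \<open>Ps\<close>, and expanding
  \<open>[Phi(P), H(P)] = 0\<close> shows that the iteration map has the derivative \<open>1 - beta J\<close> along the manifold.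
\<close>

section \<open>Self-adjoint operators on a subspace\<close>

text \<open>Two obstacles shape the argument. \<open>Phi\<close> comes from a choice of
  eigenvectors, so no smooth dependence on \<open>P\<close> is at hand and \<open>Phi\<close> is
  never differentiated directly. Subtracting two commutation relations gives an exact equation for
  \<open>Om (Phi P - Ps)\<close> whose remainder is a product of two small factors; invertibility of
  \<open>Om\<close> turns it into a first-order expansion. The gap is carried along as an inequality
  on the manifold rather than through eigenvalues, so stability requires nothing of the spectrum of
  the perturbed matrix. Secondly, the iterates live on a curved set: \<open>P - Ps\<close> is not
  tangent, and the \<open>Om\<close> product is definite only on the tangent space. The error is
  therefore the \<open>Om\<close> norm of the tangent part plus the Frobenius norm of the normal
  part. Since no power of the operator has to be taken to reach the radius, \<open>theta\<close>
  only absorbs nonlinear remainders.\<close>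

lemma semidefinite_Cauchy_Schwarz:
  fixes M :: "'a::real_vector \<Rightarrow> 'a \<Rightarrow> real"
  assumes M: "bilinear M" and T: "subspace T"
    and sym: "\<And>x y. x \<in> T \<Longrightarrow> y \<in> T \<Longrightarrow> M x y = M y x"
    and psd: "\<And>x. x \<in> T \<Longrightarrow> 0 \<le> M x x"
    and x: "x \<in> T" and y: "y \<in> T"
  shows "(M x y)\<^sup>2 \<le> M x x * M y y"
proof -
  define a b c where "a = M x y" and "b = M y y" and "c = M x x"
  have q: "0 \<le> c + 2 * t * a + t\<^sup>2 * b" for t
  proof -
    have "x + t *\<^sub>R y \<in> T" using T x y by (simp add: subspace_add subspace_scale)
    from psd[OF this] show ?thesis
      using sym[OF x y]
      by (simp add: bilinear_ladd[OF M] bilinear_radd[OF M] bilinear_lmul[OF M] bilinear_rmul[OF M]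
          a_def b_def c_def power2_eq_square algebra_simps)
  qed
  have "b \<ge> 0" using psd[OF y] by (simp add: b_def)
  have "a\<^sup>2 \<le> c * b"
  proof (cases "b = 0")
    case True
    \<comment> \<open>With \<open>b = 0\<close> the bound \<open>q\<close> makes an affine function
      of \<open>t\<close> nonnegative everywhere, so its slope vanishes.\<close>
    have "a = 0"
    proof (rule ccontr)
      assume "a \<noteq> 0"
      hence "2 * (- (c + 1) / (2 * a)) * a = - (c + 1)" by (simp add: field_simps)
      then obtain t where "2 * t * a = - (c + 1)" by blast
      thus False using q[of t] True by simp
    qed
    thus ?thesis using True by simp
  next
    case False
    have "0 \<le> c - a\<^sup>2 / b" using q[of "- a / b"] False by (simp add: power2_eq_square field_simps)
    thus ?thesis using False \<open>b \<ge> 0\<close> by (simp add: field_simps)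
  qed
  thus ?thesis by (simp add: a_def b_def c_def)
qed

text \<open>The form \<open>B\<close> is a parameter because two instances occur: the Euclidean
  product on vectors, for eigenbases of symmetric matrices, and the product weighted by
  \<open>Om\<close> on the tangent space.\<close>

locale selfadjoint_on =
  fixes B :: "'a::euclidean_space \<Rightarrow> 'a \<Rightarrow> real" and T :: "'a set" and L :: "'a \<Rightarrow> 'a"
  assumes B: "bilinear B" and L: "linear L" and T: "subspace T"
    and LT: "\<And>x. x \<in> T \<Longrightarrow> L x \<in> T"
    and sym: "\<And>x y. x \<in> T \<Longrightarrow> y \<in> T \<Longrightarrow> B x y = B y x"
    and pd: "\<And>x. x \<in> T \<Longrightarrow> x \<noteq> 0 \<Longrightarrow> 0 < B x x"
    and sa: "\<And>x y. x \<in> T \<Longrightarrow> y \<in> T \<Longrightarrow> B (L x) y = B x (L y)"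
begin

lemma rayleigh_max:
  assumes nz: "T \<noteq> {0}"
  shows "\<exists>x mu. x \<in> T \<and> B x x = 1 \<and> L x = mu *\<^sub>R x \<and> (\<forall>y\<in>T. B y (L y) \<le> mu * B y y)"
proof -
  have bB: "bounded_bilinear B" using B bilinear_conv_bounded_bilinear by blast
  have bL: "bounded_linear L" using L linear_conv_bounded_linear by blast
  \<comment> \<open>The Euclidean sphere supplies compactness; the quotient is homogeneous of degree
    0, so its maximum there is the maximum over all nonzero vectors of \<open>T\<close>.\<close>
  define S where "S = T \<inter> sphere 0 1"
  have cS: "compact S" unfolding S_def
    using T closed_subspace by (intro closed_Int_compact) auto
  obtain z where z: "z \<in> T" "z \<noteq> 0" using nz T subspace_0 by blast
  have "(1 / norm z) *\<^sub>R z \<in> S" using z T by (simp add: S_def subspace_scale)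
  hence neS: "S \<noteq> {}" by blast
  have S: "y \<in> T \<and> y \<noteq> 0" if "y \<in> S" for y using that by (auto simp: S_def)
  have "continuous_on S (\<lambda>y. B y (L y) / B y y)"
    using pd S less_irrefl
    by (intro continuous_intros bounded_bilinear.continuous_on[OF bB] linear_continuous_on[OF bL])
       fastforce
  then obtain x where x: "x \<in> S" "\<And>y. y \<in> S \<Longrightarrow> B y (L y) / B y y \<le> B x (L x) / B x x"
    using continuous_attains_sup[OF cS neS] by blast
  define mu where "mu = B x (L x) / B x x"
  have xT: "x \<in> T" "x \<noteq> 0" using S x by auto
  have le: "B y (L y) \<le> mu * B y y" if "y \<in> T" for y
  proof (cases "y = 0")
    case True
    then show ?thesis by (simp add: bilinear_lzero[OF B])
  next
    case False
    define w where "w = (1 / norm y) *\<^sub>R y"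
    have yw: "y = norm y *\<^sub>R w" using False by (simp add: w_def)
    have w: "w \<in> S" using False that T by (simp add: S_def w_def subspace_scale)
    have "B w (L w) \<le> mu * B w w" using x(2)[OF w] pd[of w] S[OF w]
      by (simp add: mu_def pos_divide_le_eq)
    hence "norm y * (norm y * B w (L w)) \<le> norm y * (norm y * (mu * B w w))"
      by (intro mult_left_mono) auto
    thus ?thesis
      by (subst (1 2 3 4) yw) (simp add: linear_cmul[OF L] bilinear_lmul[OF B] bilinear_rmul[OF B] algebra_simps)
  qed
  \<comment> \<open>Semidefinite by maximality and zero at the maximizer, so Cauchy-Schwarz puts
    \<open>x\<close> in its kernel. This replaces differentiating the quotient.\<close>
  define M where "M u v = mu * B u v - B u (L v)" for u v
  have M: "bilinear M"
    unfolding bilinear_def M_def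
    by (intro conjI allI linearI)
       (simp_all add: bilinear_ladd[OF B] bilinear_radd[OF B] bilinear_lmul[OF B] bilinear_rmul[OF B]
         linear_add[OF L] linear_cmul[OF L] algebra_simps)
  have 0: "M x y = 0" if "y \<in> T" for y
  proof -
    have "(M x y)\<^sup>2 \<le> M x x * M y y"
    proof (rule semidefinite_Cauchy_Schwarz[OF M T _ _ xT(1) that])
      show "M u v = M v u" if "u \<in> T" "v \<in> T" for u v
        using sa[OF that] sym[OF that] sym[of "L u" v] that LT by (simp add: M_def)
      show "0 \<le> M u u" if "u \<in> T" for u using le[OF that] by (simp add: M_def)
    qed
    moreover have "M x x = 0" using pd[OF xT] by (simp add: M_def mu_def)
    ultimately show ?thesis by simp
  qed
  define u where "u = mu *\<^sub>R x - L x"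
  have uT: "u \<in> T" unfolding u_def using xT LT T by (simp add: subspace_diff subspace_scale)
  have "B u u = mu * B x u - B (L x) u"
    unfolding u_def by (simp add: bilinear_lsub[OF B] bilinear_lmul[OF B])
  also have "\<dots> = 0" using 0[OF uT] sa[OF xT(1) uT] by (simp add: M_def)
  finally have "u = 0" using pd[OF uT] by force
  hence Lx: "L x = mu *\<^sub>R x" by (simp add: u_def)
  define e where "e = (1 / sqrt (B x x)) *\<^sub>R x"
  have "e \<in> T" using xT T by (simp add: e_def subspace_scale)
  moreover have "B e e = 1" using pd[OF xT] by (simp add: e_def bilinear_lmul[OF B] bilinear_rmul[OF B])
  moreover have "L e = mu *\<^sub>R e" by (simp add: e_def linear_cmul[OF L] Lx)
  ultimately show ?thesis using le by blast
qed

end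

text \<open>A Rayleigh maximizer yields the largest eigenvalue first, so it is appended at the last
  index; the result has the nondecreasing order that \<open>eigdec\<close> demands.\<close>

lemma spectral_theorem:
  assumes "selfadjoint_on B T L"
  shows "\<exists>e l. (\<forall>i<dim T. e i \<in> T \<and> L (e i) = l i *\<^sub>R e i) \<and>
     (\<forall>i<dim T. \<forall>j<dim T. B (e i) (e j) = (if i = j then 1 else 0)) \<and>
     (\<forall>i j. i \<le> j \<and> j < dim T \<longrightarrow> l i \<le> l j) \<and>
     (\<forall>x\<in>T. x = (\<Sum>i<dim T. B (e i) x *\<^sub>R e i))"
  using assms
proof (induction "dim T" arbitrary: T)
  case 0
  interpret selfadjoint_on B T L by fact
  have "T \<subseteq> {0}" using 0(1) by (metis dim_eq_0)
  hence "T = {0}" using subspace_0[OF T] by auto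
  thus ?case by (simp add: bilinear_rzero[OF B])
next
  case (Suc n)
  interpret selfadjoint_on B T L by fact
  have nz: "T \<noteq> {0}" using Suc(2) by auto
  obtain x mu where x: "x \<in> T" "B x x = 1" "L x = mu *\<^sub>R x"
      and le: "\<And>y. y \<in> T \<Longrightarrow> B y (L y) \<le> mu * B y y"
    using rayleigh_max[OF nz] by blast
  \<comment> \<open>The \<open>B\<close>-orthogonal complement of \<open>x\<close> in
    \<open>T\<close>; self-adjointness makes it invariant under \<open>L\<close>.\<close>
  define T' where "T' = {y \<in> T. B x y = 0}"
  have sT': "subspace T'"
    using T by (auto simp: T'_def subspace_def bilinear_radd[OF B] bilinear_rmul[OF B] bilinear_rzero[OF B])
  have T'T: "T' \<subseteq> T" by (auto simp: T'_def)
  have x0: "x \<noteq> 0" using x by (auto simp: bilinear_lzero[OF B])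
  have pr: "y - B x y *\<^sub>R x \<in> T'" if "y \<in> T" for y
    using that x T by (simp add: T'_def subspace_diff subspace_scale bilinear_rsub[OF B] bilinear_rmul[OF B])
  have "T \<subseteq> span (insert x T')"
  proof
    fix y assume "y \<in> T"
    from pr[OF this] have "y - B x y *\<^sub>R x \<in> span (insert x T')" by (simp add: span_base)
    from span_add[OF this span_scale[OF span_base[of x], of _ "B x y"]] show "y \<in> span (insert x T')" by simp
  qed
  hence "span (insert x T') = T"
    by (metis T T'T insert_subset span_minimal subset_antisym x(1))
  moreover have "x \<notin> span T'" using x(2) sT' by (simp add: span_eq_iff[THEN iffD2] T'_def)
  ultimately have "dim T = dim T' + 1" by (metis dim_insert dim_span)
  hence dT': "n = dim T'" using Suc(2) by simp
  have LT': "L y \<in> T'" if "y \<in> T'" for y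
    using that sa[OF x(1), of y] LT by (simp add: T'_def x(3) bilinear_lmul[OF B])
  have sa': "selfadjoint_on B T' L"
  proof (rule selfadjoint_on.intro)
    fix y z assume yz: "y \<in> T'" "z \<in> T'"
    show "B y z = B z y" "B (L y) z = B y (L z)"
      using yz by (auto intro!: sym sa subsetD[OF T'T])
  qed (use B L sT' LT' subsetD[OF T'T] pd in auto)
  obtain e l where IH: "\<forall>i<dim T'. e i \<in> T' \<and> L (e i) = l i *\<^sub>R e i"
     "\<forall>i<dim T'. \<forall>j<dim T'. B (e i) (e j) = (if i = j then 1 else 0)"
     "\<forall>i j. i \<le> j \<and> j < dim T' \<longrightarrow> l i \<le> l j"
     "\<forall>x\<in>T'. x = (\<Sum>i<dim T'. B (e i) x *\<^sub>R e i)"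
    using Suc(1)[OF dT' sa'] by blast
  have li: "l i \<le> mu" if "i < n" for i
    using le[of "e i"] IH(1,2) that T'T by (auto simp: dT' bilinear_rmul[OF B])
  have eT: "e i \<in> T" "B x (e i) = 0" "B (e i) x = 0" if "i < n" for i
    using IH(1) that sym[of "e i" x] x by (auto simp: dT' T'_def)
  show ?case unfolding Suc(2)[symmetric]
  proof (intro exI[of _ "e(n := x)"] exI[of _ "l(n := mu)"] conjI allI impI ballI)
    fix y assume y: "y \<in> T"
    have "y - B x y *\<^sub>R x = (\<Sum>i<n. B (e i) (y - B x y *\<^sub>R x) *\<^sub>R e i)"
      using IH(4) pr[OF y] dT' by auto
    also have "\<dots> = (\<Sum>i<n. B (e i) y *\<^sub>R e i)"
      by (intro sum.cong) (auto simp: bilinear_rsub[OF B] bilinear_rmul[OF B] eT)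
    finally have "y = (\<Sum>i<n. B (e i) y *\<^sub>R e i) + B x y *\<^sub>R x" by (simp add: algebra_simps)
    thus "y = (\<Sum>i<Suc n. B ((e(n := x)) i) y *\<^sub>R (e(n := x)) i)" by simp
  next
    fix i j assume "i < Suc n" "j < Suc n"
    thus "B ((e(n := x)) i) ((e(n := x)) j) = (if i = j then 1 else 0)"
      using IH(2) eT x(2) by (auto simp: dT'[symmetric] less_Suc_eq)
  next
    fix i j assume "i \<le> j \<and> j < Suc n"
    thus "(l(n := mu)) i \<le> (l(n := mu)) j"
      using IH(3) li by (cases "j = n"; cases "i = n") (auto simp: dT'[symmetric])
  next
    fix i assume "i < Suc n"
    thus "(e(n := x)) i \<in> T" "L ((e(n := x)) i) = (l(n := mu)) i *\<^sub>R (e(n := x)) i"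
      using IH(1) eT(1) x by (auto simp: dT'[symmetric] less_Suc_eq)
  qed
qed

context selfadjoint_on
begin

lemma nonneg: "x \<in> T \<Longrightarrow> 0 \<le> B x x"
  using pd[of x] bilinear_lzero[OF B] by (cases "x = 0") auto

lemma form_triangle:
  assumes "x \<in> T" "y \<in> T"
  shows "sqrt (B (x + y) (x + y)) \<le> sqrt (B x x) + sqrt (B y y)"
proof (rule real_le_lsqrt)
  have "(B x y)\<^sup>2 \<le> B x x * B y y"
    by (rule semidefinite_Cauchy_Schwarz[OF B T _ nonneg assms]) (auto intro: sym)
  hence "\<bar>B x y\<bar> \<le> sqrt (B x x) * sqrt (B y y)" by (metis real_sqrt_abs real_sqrt_le_iff real_sqrt_mult)
  thus "B (x + y) (x + y) \<le> (sqrt (B x x) + sqrt (B y y))\<^sup>2"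
    using nonneg[OF assms(1)] nonneg[OF assms(2)] sym[OF assms]
    by (simp add: bilinear_ladd[OF B] bilinear_radd[OF B] power2_sum)
  show "0 \<le> sqrt (B x x) + sqrt (B y y)" using nonneg assms by simp
qed

lemma eigenexpansion:
  assumes e: "\<forall>i<n. e i \<in> T \<and> L (e i) = l i *\<^sub>R e i"
    and ex: "\<forall>x\<in>T. x = (\<Sum>i<n. B (e i) x *\<^sub>R e i)"
    and x: "x \<in> T"
  shows "B x x = (\<Sum>i<n. (B (e i) x)\<^sup>2)" and "i < n \<Longrightarrow> B (e i) (L x) = l i * B (e i) x"
proof -
  have "B x x = B (\<Sum>i<n. B (e i) x *\<^sub>R e i) x"
    using arg_cong[OF ex[rule_format, OF x], of "\<lambda>y. B y x"] .
  also have "\<dots> = (\<Sum>i<n. (B (e i) x)\<^sup>2)"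
    using B unfolding bilinear_def by (subst linear_sum[of "\<lambda>y. B y x"])
      (auto simp: bilinear_lmul[OF B] power2_eq_square)
  finally show "B x x = (\<Sum>i<n. (B (e i) x)\<^sup>2)" .
  assume "i < n"
  thus "B (e i) (L x) = l i * B (e i) x"
    using sa[of "e i" x] x e by (simp add: bilinear_lmul[OF B])
qed

text \<open>Eigenvalues of the complexification are real and occur in the eigenbasis, so the set
  under \<open>Max\<close> is finite; it is nonempty because \<open>T\<close> is not trivial. In the
  second claim the radius acts as an operator norm, since an orthonormal eigenbasis admits no larger
  factor.\<close>

lemma spectral_radius:
  assumes nz: "T \<noteq> {0}"
  shows "\<exists>x\<in>T. \<exists>mu. x \<noteq> 0 \<and> L x = mu *\<^sub>R x \<and> op_spectral_radius T L = \<bar>mu\<bar>"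
    and "\<And>x. x \<in> T \<Longrightarrow> B (L x) (L x) \<le> (op_spectral_radius T L)\<^sup>2 * B x x"
proof -
  define n where "n = dim T"
  obtain e l where el: "\<forall>i<n. e i \<in> T \<and> L (e i) = l i *\<^sub>R e i"
     "\<forall>i<n. \<forall>j<n. B (e i) (e j) = (if i = j then 1 else 0)"
     "\<forall>x\<in>T. x = (\<Sum>i<n. B (e i) x *\<^sub>R e i)"
    using spectral_theorem[OF selfadjoint_on_axioms] unfolding n_def[symmetric] by (elim exE conjE)
  have e: "e i \<in> T" "L (e i) = l i *\<^sub>R e i" if "i < n" for i using el(1) that by blast+
  have on: "B (e i) (e j) = (if i = j then 1 else 0)" if "i < n" "j < n" for i j
    using el(2) that by blast
  note ex = el(3)[rule_format]
  note E = eigenexpansion[OF el(1,3)]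
  have n: "n > 0" using nz T subspace_0 dim_eq_0 unfolding n_def by blast
  have e0: "e i \<noteq> 0" if "i < n" for i using on[OF that that] bilinear_lzero[OF B] by auto
  have eig: "z \<in> (\<lambda>i. complex_of_real (l i)) ` {..<n}" if z: "op_eigenvalue T L z" for z
  proof -
    obtain x y where xy: "x \<in> T" "y \<in> T" "x \<noteq> 0 \<or> y \<noteq> 0"
      "L x = Re z *\<^sub>R x - Im z *\<^sub>R y" "L y = Im z *\<^sub>R x + Re z *\<^sub>R y"
      using z unfolding op_eigenvalue_def by blast
    \<comment> \<open>Evaluating \<open>B (L x) y = B x (L y)\<close> on the real and imaginary
      parts of an eigenvector leaves \<open>Im z\<close> times a positive number.\<close>
    have "Im z * (B x x + B y y) = 0"
      using sa[OF xy(1,2)] sym[OF xy(1,2)] unfolding xy(4,5)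
      by (simp add: bilinear_lsub[OF B] bilinear_radd[OF B] bilinear_lmul[OF B] bilinear_rmul[OF B] algebra_simps)
    moreover have "B x x \<ge> 0" "B y y \<ge> 0" using pd[OF xy(1)] pd[OF xy(2)] bilinear_lzero[OF B] by force+
    hence "B x x + B y y > 0" using pd[OF xy(1)] pd[OF xy(2)] xy(3) by force
    ultimately have im: "Im z = 0" by simp
    obtain w where w: "w \<in> T" "w \<noteq> 0" "L w = Re z *\<^sub>R w" using xy im by auto
    obtain i where i: "i < n" "B (e i) w \<noteq> 0"
    proof (rule ccontr)
      assume "\<not> thesis"
      hence "(\<Sum>i<n. B (e i) w *\<^sub>R e i) = 0" using that by (intro sum.neutral) auto
      from trans[OF ex[OF w(1)] this] w(2) show False by blast
    qed
    have "Re z = l i" using E(2)[OF w(1) i(1)] i(2) by (simp add: w(3) bilinear_rmul[OF B])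
    thus ?thesis using i(1) im by (auto intro!: image_eqI[of _ _ i] complex_eqI)
  qed
  have eig': "op_eigenvalue T L (complex_of_real (l i))" if "i < n" for i
    unfolding op_eigenvalue_def using e[OF that] e0[OF that] T subspace_0
    by (intro exI[of _ "e i"] exI[of _ 0]) (auto simp: linear_0[OF L])
  have S: "{z. op_eigenvalue T L z} = (\<lambda>i. complex_of_real (l i)) ` {..<n}" using eig eig' by auto
  have S': "{cmod z |z. op_eigenvalue T L z} = (\<lambda>i. \<bar>l i\<bar>) ` {..<n}"
    unfolding setcompr_eq_image S by (auto simp: image_image)
  have r: "op_spectral_radius T L = Max ((\<lambda>i. \<bar>l i\<bar>) ` {..<n})"
    unfolding op_spectral_radius_def S' ..
  have "Max ((\<lambda>i. \<bar>l i\<bar>) ` {..<n}) \<in> (\<lambda>i. \<bar>l i\<bar>) ` {..<n}" using n by (intro Max_in) auto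
  then obtain i where "i < n" "op_spectral_radius T L = \<bar>l i\<bar>" by (auto simp: r)
  thus "\<exists>x\<in>T. \<exists>mu. x \<noteq> 0 \<and> L x = mu *\<^sub>R x \<and> op_spectral_radius T L = \<bar>mu\<bar>" using e e0 by metis
  fix x assume x: "x \<in> T"
  have li: "(l i)\<^sup>2 \<le> (op_spectral_radius T L)\<^sup>2" if "i < n" for i
  proof -
    have "\<bar>l i\<bar> \<le> op_spectral_radius T L" unfolding r using that by (intro Max_ge) auto
    thus ?thesis by (metis abs_ge_zero power2_abs power_mono)
  qed
  show "B (L x) (L x) \<le> (op_spectral_radius T L)\<^sup>2 * B x x"
    unfolding E(1)[OF x] E(1)[OF LT[OF x]] sum_distrib_left
    using li by (intro sum_mono) (simp add: E(2)[OF x] power_mult_distrib mult_right_mono)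
qed
end

section \<open>Second derivatives\<close>

text \<open>Both mixed derivatives are limits of the same second difference over \<open>t^2\<close>.
  The mean value theorem is used in one direction only, so differentiability of \<open>f'\<close> at
  the single point \<open>x\<close> suffices.\<close>

lemma second_derivative_symmetric:
  fixes f :: "'a::real_normed_vector \<Rightarrow> real"
  assumes f: "\<And>x. (f has_derivative blinfun_apply (f' x)) (at x)"
    and f': "(f' has_derivative blinfun_apply f'') (at x)"
  shows "f'' u v = f'' v u"
proof -
  have main: "\<exists>c\<ge>0. \<forall>eps>0. \<exists>d>0. \<forall>t. 0 < t \<and> t < d \<longrightarrow>
      \<bar>f (x + t *\<^sub>R u + t *\<^sub>R v) - f (x + t *\<^sub>R u) - f (x + t *\<^sub>R v) + f x - t\<^sup>2 * f'' v u\<bar> \<le> eps * c * t\<^sup>2"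
    for u v
  \<comment> \<open>The two expansion points lie within \<open>t * (norm u + norm v)\<close> and
    \<open>t * norm u\<close> of \<open>x\<close>; the sum of these bounds, applied to
    \<open>u\<close>, gives the constant.\<close>
  proof (rule exI[of _ "(2 * norm u + norm v) * norm u"], intro conjI allI impI)
    fix eps :: real assume eps: "eps > 0"
    obtain d where d: "d > 0" "\<And>y. norm (y - x) < d \<Longrightarrow> norm (f' y - f' x - f'' (y - x)) \<le> eps * norm (y - x)"
      using f' eps unfolding has_derivative_at_alt by metis
    define d' where "d' = d / (norm u + norm v + 1)"
    have nn: "norm u + norm v + 1 > 0" by (smt (verit) norm_ge_zero)
    show "\<exists>d>0. \<forall>t. 0 < t \<and> t < d \<longrightarrow>
      \<bar>f (x + t *\<^sub>R u + t *\<^sub>R v) - f (x + t *\<^sub>R u) - f (x + t *\<^sub>R v) + f x - t\<^sup>2 * f'' v u\<bar>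
        \<le> eps * ((2 * norm u + norm v) * norm u) * t\<^sup>2"
    proof (intro exI[of _ d'] conjI allI impI)
      show "d' > 0" using d(1) nn by (simp add: d'_def)
      fix t assume t: "0 < t \<and> t < d'"
      define g where "g s = f (x + s *\<^sub>R u + t *\<^sub>R v) - f (x + s *\<^sub>R u)" for s
      have "\<exists>s. 0 < s \<and> s < t \<and> g t - g 0 = (t - 0) * (f' (x + s *\<^sub>R u + t *\<^sub>R v) u - f' (x + s *\<^sub>R u) u)"
      proof (rule MVT2)
        show "0 < t" using t by simp
        fix s
        have "(g has_derivative (\<lambda>h. f' (x + s *\<^sub>R u + t *\<^sub>R v) (h *\<^sub>R u) - f' (x + s *\<^sub>R u) (h *\<^sub>R u))) (at s)"
          unfolding g_def
          by (intro has_derivative_diff has_derivative_compose[OF _ f]) (auto intro!: derivative_eq_intros)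
        thus "DERIV g s :> f' (x + s *\<^sub>R u + t *\<^sub>R v) u - f' (x + s *\<^sub>R u) u"
          unfolding has_field_derivative_def
          by (rule has_derivative_eq_rhs) (auto simp: blinfun.scaleR_right algebra_simps)
      qed
      then obtain s where s: "0 < s" "s < t"
        and gs: "g t - g 0 = t * (f' (x + s *\<^sub>R u + t *\<^sub>R v) u - f' (x + s *\<^sub>R u) u)" by auto
      define h1 h2 where "h1 = s *\<^sub>R u + t *\<^sub>R v" and "h2 = s *\<^sub>R u"
      have h1: "norm h1 \<le> t * (norm u + norm v)" unfolding h1_def
        using s t norm_triangle_ineq[of "s *\<^sub>R u" "t *\<^sub>R v"] mult_right_mono[of s t "norm u"]
        by (simp add: algebra_simps)
      have h2: "norm h2 \<le> t * norm u" unfolding h2_def using s by (simp add: mult_right_mono)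
      have "t * (norm u + norm v + 1) < d" using t nn by (simp add: d'_def pos_less_divide_eq)
      moreover have "t * (norm u + norm v + 1) = t * norm u + t * norm v + t"
        "t * (norm u + norm v) = t * norm u + t * norm v" by (simp_all add: algebra_simps)
      moreover have "t * norm v \<ge> 0" using t by (intro mult_nonneg_nonneg) auto
      ultimately have "norm h1 < d" "norm h2 < d" using h1 h2 t by linarith+
      hence b: "norm (f' (x + h1) - f' x - f'' h1) \<le> eps * norm h1"
            "norm (f' (x + h2) - f' x - f'' h2) \<le> eps * norm h2"
        using d(2)[of "x + h1"] d(2)[of "x + h2"] by auto
      define r where "r = (f' (x + h1) - f' x - f'' h1) - (f' (x + h2) - f' x - f'' h2)"
      have r1: "norm r \<le> eps * norm h1 + eps * norm h2"
        unfolding r_def using b norm_triangle_ineq4 order_trans add_mono by meson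
      also have "\<dots> \<le> eps * (t * (norm u + norm v)) + eps * (t * norm u)"
        using h1 h2 eps by (intro add_mono mult_left_mono) auto
      finally have rb: "norm r \<le> eps * t * (2 * norm u + norm v)" by (simp add: algebra_simps)
      have "h1 = h2 + t *\<^sub>R v" by (simp add: h1_def h2_def)
      hence "r = f' (x + h1) - f' (x + h2) - t *\<^sub>R f'' v"
        unfolding r_def by (simp add: blinfun.add_right blinfun.scaleR_right)
      hence "g t - g 0 - t\<^sup>2 * f'' v u = t * r u"
        using gs by (simp add: h1_def h2_def blinfun.diff_left blinfun.scaleR_left right_diff_distrib add.assoc power2_eq_square)
      hence "\<bar>g t - g 0 - t\<^sup>2 * f'' v u\<bar> = t * \<bar>r u\<bar>" using t by (simp add: abs_mult)
      also have "\<dots> \<le> t * ((eps * t * (2 * norm u + norm v)) * norm u)"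
        using norm_blinfun[of r u] mult_right_mono[OF rb norm_ge_zero[of u]] t
        by (intro mult_left_mono) auto
      finally show "\<bar>f (x + t *\<^sub>R u + t *\<^sub>R v) - f (x + t *\<^sub>R u) - f (x + t *\<^sub>R v) + f x - t\<^sup>2 * f'' v u\<bar>
        \<le> eps * ((2 * norm u + norm v) * norm u) * t\<^sup>2"
        by (simp add: g_def algebra_simps power2_eq_square)
    qed
  qed simp
  obtain c1 where c1: "c1 \<ge> 0" "\<And>eps. eps > 0 \<Longrightarrow> \<exists>d>0. \<forall>t. 0 < t \<and> t < d \<longrightarrow>
      \<bar>f (x + t *\<^sub>R u + t *\<^sub>R v) - f (x + t *\<^sub>R u) - f (x + t *\<^sub>R v) + f x - t\<^sup>2 * f'' v u\<bar> \<le> eps * c1 * t\<^sup>2"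
    using main[of u v] by blast
  obtain c2 where c2: "c2 \<ge> 0" "\<And>eps. eps > 0 \<Longrightarrow> \<exists>d>0. \<forall>t. 0 < t \<and> t < d \<longrightarrow>
      \<bar>f (x + t *\<^sub>R v + t *\<^sub>R u) - f (x + t *\<^sub>R v) - f (x + t *\<^sub>R u) + f x - t\<^sup>2 * f'' u v\<bar> \<le> eps * c2 * t\<^sup>2"
    using main[of v u] by blast
  have "\<bar>f'' v u - f'' u v\<bar> \<le> 0 + eps" if "eps > 0" for eps
  proof -
    define e where "e = eps / (c1 + c2 + 1)"
    have e: "e > 0" using that c1(1) c2(1) by (simp add: e_def)
    obtain d1 d2 where d: "d1 > 0" "d2 > 0" and
       D: "\<And>t. 0 < t \<and> t < d1 \<Longrightarrow> \<bar>f (x + t *\<^sub>R u + t *\<^sub>R v) - f (x + t *\<^sub>R u) - f (x + t *\<^sub>R v) + f x - t\<^sup>2 * f'' v u\<bar> \<le> e * c1 * t\<^sup>2"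
          "\<And>t. 0 < t \<and> t < d2 \<Longrightarrow> \<bar>f (x + t *\<^sub>R v + t *\<^sub>R u) - f (x + t *\<^sub>R v) - f (x + t *\<^sub>R u) + f x - t\<^sup>2 * f'' u v\<bar> \<le> e * c2 * t\<^sup>2"
      using c1(2)[OF e] c2(2)[OF e] by blast
    define t where "t = min d1 d2 / 2"
    have t: "0 < t \<and> t < d1" "0 < t \<and> t < d2" using d by (auto simp: t_def min_def)
    have "\<bar>t\<^sup>2 * f'' v u - t\<^sup>2 * f'' u v\<bar> \<le> e * c1 * t\<^sup>2 + e * c2 * t\<^sup>2"
      using D(1)[OF t(1)] D(2)[OF t(2)] by (simp add: add.assoc add.commute[of "t *\<^sub>R u"])
    hence "t\<^sup>2 * \<bar>f'' v u - f'' u v\<bar> \<le> t\<^sup>2 * (e * (c1 + c2))"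
      by (simp add: right_diff_distrib[symmetric] abs_mult) (simp add: algebra_simps)
    hence "\<bar>f'' v u - f'' u v\<bar> \<le> e * (c1 + c2)" using t by simp
    also have "\<dots> \<le> e * (c1 + c2 + 1)" using e by simp
    also have "\<dots> = eps" using c1(1) c2(1) by (simp add: e_def)
    finally show ?thesis by simp
  qed
  hence "\<bar>f'' v u - f'' u v\<bar> \<le> 0" by (rule field_le_epsilon)
  thus ?thesis by simp
qed

text \<open>Subtracting the candidate polynomial and applying the mean value theorem once leaves the
  first-order remainder of \<open>f'\<close> at \<open>x\<close>; second derivatives at other points
  never appear.\<close>

lemma taylor_second_order:
  fixes f :: "'a::real_normed_vector \<Rightarrow> real"
  assumes f: "\<And>x. (f has_derivative blinfun_apply (f' x)) (at x)"
    and f': "(f' has_derivative blinfun_apply f'') (at x)" and eps: "eps > 0"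
  shows "\<exists>d>0. \<forall>h. norm h < d \<longrightarrow> \<bar>f (x + h) - f x - f' x h - f'' h h / 2\<bar> \<le> eps * (norm h)\<^sup>2"
proof -
  obtain d where d: "d > 0" "\<And>y. norm (y - x) < d \<Longrightarrow> norm (f' y - f' x - f'' (y - x)) \<le> eps * norm (y - x)"
    using f' eps unfolding has_derivative_at_alt by metis
  show ?thesis
  proof (intro exI[of _ d] conjI allI impI d(1))
    fix h :: 'a assume h: "norm h < d"
    define g where "g t = f (x + t *\<^sub>R h) - t * f' x h - t\<^sup>2 * f'' h h / 2" for t
    have "\<exists>t. 0 < t \<and> t < 1 \<and> g 1 - g 0 = (1 - 0) * (f' (x + t *\<^sub>R h) h - f' x h - t * f'' h h)"
    proof (rule MVT2)
      fix t
      have "((\<lambda>t. f (x + t *\<^sub>R h)) has_derivative (\<lambda>s. f' (x + t *\<^sub>R h) (s *\<^sub>R h))) (at t)"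
        by (rule has_derivative_compose[OF _ f]) (auto intro!: derivative_eq_intros)
      hence "DERIV (\<lambda>t. f (x + t *\<^sub>R h)) t :> f' (x + t *\<^sub>R h) h"
        unfolding has_field_derivative_def
        by (rule has_derivative_eq_rhs) (auto simp: blinfun.scaleR_right algebra_simps)
      thus "DERIV g t :> f' (x + t *\<^sub>R h) h - f' x h - t * f'' h h"
        unfolding g_def by (auto intro!: derivative_eq_intros)
    qed simp
    then obtain t where t: "0 < t" "t < 1" "g 1 - g 0 = f' (x + t *\<^sub>R h) h - f' x h - t * f'' h h" by auto
    have th: "norm (t *\<^sub>R h) \<le> norm h" using t by (simp add: mult_left_le_one_le)
    have "norm (f' (x + t *\<^sub>R h) - f' x - f'' (t *\<^sub>R h)) \<le> eps * norm (t *\<^sub>R h)"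
      using d(2)[of "x + t *\<^sub>R h"] th h by auto
    also have "\<dots> \<le> eps * norm h" using th eps by (intro mult_left_mono) auto
    finally have "norm (f' (x + t *\<^sub>R h) - f' x - f'' (t *\<^sub>R h)) * norm h \<le> eps * norm h * norm h"
      by (intro mult_right_mono) auto
    moreover have "g 1 - g 0 = (f' (x + t *\<^sub>R h) - f' x - f'' (t *\<^sub>R h)) h"
      using t(3) by (simp add: blinfun.diff_left blinfun.scaleR_right blinfun.scaleR_left)
    ultimately have "\<bar>g 1 - g 0\<bar> \<le> eps * norm h * norm h"
      using norm_blinfun[of "f' (x + t *\<^sub>R h) - f' x - f'' (t *\<^sub>R h)" h] by simp
    thus "\<bar>f (x + h) - f x - f' x h - f'' h h / 2\<bar> \<le> eps * (norm h)\<^sup>2"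
      by (simp add: g_def power2_eq_square algebra_simps)
  qed
qed

section \<open>Linear convergence from an asymptotic contraction\<close>

text \<open>The radius \<open>d\<close> is chosen before \<open>th\<close>, while the region where
  the factor \<open>r + th\<close> holds shrinks with \<open>th\<close>. A fixed factor
  \<open>q\<close> between \<open>r\<close> and 1 keeps every orbit near \<open>p\<close> and drives
  it into the smaller region after \<open>K\<close> steps, uniformly in the start; the constant pays
  for those first steps.\<close>

lemma local_linear_convergence:
  fixes F :: "'a::real_normed_vector \<Rightarrow> 'a"
  assumes c: "c1 > 0" "c2 > 0"
    and e: "\<And>P. P \<in> S \<Longrightarrow> c1 * norm (P - p) \<le> e P" "\<And>P. P \<in> S \<Longrightarrow> e P \<le> c2 * norm (P - p)"
    and r: "0 \<le> r" "r < 1"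
    and step: "\<And>eps. eps > 0 \<Longrightarrow> \<exists>d>0. \<forall>P\<in>S. norm (P - p) < d \<longrightarrow> F P \<in> S \<and> e (F P) \<le> (r + eps) * e P"
    and d0: "d0 > 0"
  shows "\<exists>d>0. \<forall>th>0. \<exists>C>0. \<forall>P\<in>S. norm (P - p) < d \<longrightarrow>
     (\<forall>k. (F ^^ k) P \<in> S \<and> norm ((F ^^ k) P - p) < d0 \<and>
        norm ((F ^^ k) P - p) \<le> C * (r + th) ^ k * norm (P - p))"
proof -
  define q where "q = (1 + r) / 2"
  have q: "0 < q" "q < 1" using r by (auto simp: q_def)
  obtain d1' where d1': "d1' > 0" "\<forall>P\<in>S. norm (P - p) < d1' \<longrightarrow> F P \<in> S \<and> e (F P) \<le> (r + (1 - r) / 2) * e P"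
    using step[of "(1 - r) / 2"] r by auto
  define d1 where "d1 = min d1' d0"
  have d1: "d1 > 0" "d1 \<le> d0" "\<And>P. P \<in> S \<Longrightarrow> norm (P - p) < d1 \<Longrightarrow> F P \<in> S \<and> e (F P) \<le> q * e P"
  proof -
    have "r + (1 - r) / 2 = q" by (simp add: q_def field_simps)
    thus "\<And>P. P \<in> S \<Longrightarrow> norm (P - p) < d1 \<Longrightarrow> F P \<in> S \<and> e (F P) \<le> q * e P" using d1'(2) by (auto simp: d1_def)
  qed (use d1'(1) d0 in \<open>auto simp: d1_def\<close>)
  define d where "d = d1 * c1 / c2"
  have d: "d > 0" using d1 c by (simp add: d_def)
  have near: "norm (Q - p) \<le> t * c2 * norm (P - p) / c1"
    if "Q \<in> S" "P \<in> S" "e Q \<le> t * e P" "t \<ge> 0" for P Q t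
  proof -
    have "c1 * norm (Q - p) \<le> t * (c2 * norm (P - p))"
      using e(1)[OF that(1)] that(3) mult_left_mono[OF e(2)[OF that(2)] that(4)] by linarith
    thus ?thesis using c by (simp add: field_simps)
  qed
  have inv: "(F ^^ k) P \<in> S \<and> e ((F ^^ k) P) \<le> q ^ k * e P \<and> norm ((F ^^ k) P - p) < d1"
    if P: "P \<in> S" "norm (P - p) < d" for P k
  proof -
    have nr: "norm (Q - p) < d1" if "Q \<in> S" "e Q \<le> q ^ k * e P" for Q k
    proof -
      have "norm (Q - p) \<le> q ^ k * c2 * norm (P - p) / c1" using near[OF that(1) P(1) that(2)] q by simp
      also have "\<dots> \<le> 1 * c2 * norm (P - p) / c1"
        using q c by (intro divide_right_mono mult_right_mono) (auto simp: power_le_one)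
      also have "\<dots> < d1" using P(2) c by (simp add: d_def field_simps)
      finally show ?thesis .
    qed
    show ?thesis
    proof (induction k)
      case 0
      then show ?case using nr[of P 0] P by simp
    next
      case (Suc k)
      have 1: "F ((F ^^ k) P) \<in> S" "e (F ((F ^^ k) P)) \<le> q * e ((F ^^ k) P)" using d1(3) Suc by auto
      have "q * e ((F ^^ k) P) \<le> q * (q ^ k * e P)" using Suc q by (intro mult_left_mono) auto
      hence "e (F ((F ^^ k) P)) \<le> q ^ Suc k * e P" using 1(2) by simp
      with nr[OF 1(1), of "Suc k"] 1(1) show ?case by simp
    qed
  qed
  show ?thesis
  proof (rule exI[of _ d], intro conjI allI impI d)
    fix th :: real assume th: "th > 0"
    obtain dt where dt: "dt > 0" "\<And>P. P \<in> S \<Longrightarrow> norm (P - p) < dt \<Longrightarrow> F P \<in> S \<and> e (F P) \<le> (r + th) * e P"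
      using step[OF th] by auto
    define s where "s = r + th"
    have s: "s > 0" using r th by (simp add: s_def)
    obtain K where K: "q ^ K < dt * c1 / (c2 * d)"
      using real_arch_pow_inv[of "dt * c1 / (c2 * d)" q] dt c d q by auto
    \<comment> \<open>As \<open>s\<close> may exceed 1, the minimum is needed for
      \<open>M * s ^ k\<close> to dominate 1 at every \<open>k\<close> up to
      \<open>K\<close>.\<close>
    define m where "m = min 1 s"
    have m: "0 < m" "m \<le> 1" "m \<le> s" using s by (auto simp: m_def)
    define M where "M = (1 / m) ^ K"
    have M: "M > 0" using m by (simp add: M_def)
    have Ms: "1 \<le> M * s ^ k" if "k \<le> K" for k
    proof -
      have "m ^ K \<le> m ^ k" using m that by (simp add: power_decreasing)
      also have "\<dots> \<le> s ^ k" using m by (simp add: power_mono)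
      finally show ?thesis using m by (simp add: M_def power_one_over field_simps)
    qed
    show "\<exists>C>0. \<forall>P\<in>S. norm (P - p) < d \<longrightarrow>
     (\<forall>k. (F ^^ k) P \<in> S \<and> norm ((F ^^ k) P - p) < d0 \<and>
        norm ((F ^^ k) P - p) \<le> C * (r + th) ^ k * norm (P - p))"
    proof (rule exI[of _ "M * c2 / c1"], intro conjI ballI allI impI)
      show "M * c2 / c1 > 0" using M c by simp
      fix P k assume P: "P \<in> S" "norm (P - p) < d"
      note I = inv[OF P]
      show "(F ^^ k) P \<in> S" "norm ((F ^^ k) P - p) < d0" using I[of k] d1(2) by auto
      have eP: "e P \<ge> 0" using e(1)[OF P(1)] c mult_nonneg_nonneg[OF less_imp_le[OF c(1)] norm_ge_zero[of "P - p"]] by linarith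
      have "e ((F ^^ k) P) \<le> M * s ^ k * e P" for k
      proof (induction k)
        case 0
        show ?case using mult_right_mono[OF Ms[of 0] eP] by simp
      next
        case (Suc k)
        show ?case
        proof (cases "Suc k \<le> K")
          case True
          have "e ((F ^^ Suc k) P) \<le> q ^ Suc k * e P" using I by blast
          also have "\<dots> \<le> 1 * e P" using q eP by (intro mult_right_mono power_le_one) auto
          also have "\<dots> \<le> M * s ^ Suc k * e P" using Ms[OF True] eP by (intro mult_right_mono) auto
          finally show ?thesis .
        next
          case False
          hence "q ^ k \<le> q ^ K" using q by (intro power_decreasing) auto
          have "norm ((F ^^ k) P - p) \<le> q ^ k * c2 * norm (P - p) / c1"
            using near[of "(F ^^ k) P" P "q ^ k"] I[of k] P q by simp
          also have "\<dots> \<le> q ^ K * c2 * d / c1"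
            using \<open>q ^ k \<le> q ^ K\<close> P(2) c q by (intro divide_right_mono mult_mono) auto
          also have "\<dots> < dt" using K c d by (simp add: field_simps)
          finally have "e ((F ^^ Suc k) P) \<le> s * e ((F ^^ k) P)" using dt(2) I[of k] by (simp add: s_def)
          also have "\<dots> \<le> s * (M * s ^ k * e P)" using Suc s by (intro mult_left_mono) auto
          finally show ?thesis by (simp add: mult_ac)
        qed
      qed
      from near[OF _ P(1) this[of k]] I[of k] M s
      show "norm ((F ^^ k) P - p) \<le> M * c2 / c1 * (r + th) ^ k * norm (P - p)"
        by (simp add: s_def mult_ac)
    qed
  qed
qed

section \<open>Spectral projectors of symmetric matrices\<close>

lemma bounded_bilinear_matrix_mult:
  "bounded_bilinear ((**) :: real^'n^'m \<Rightarrow> real^'p^'n \<Rightarrow> real^'p^'m)"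
  unfolding bilinear_conv_bounded_bilinear[symmetric] bilinear_def
  by (auto intro!: linearI simp: matrix_matrix_mult_def vec_eq_iff sum.distrib sum_distrib_left algebra_simps)

interpretation mm: bounded_bilinear "(**) :: real^'n^'m \<Rightarrow> real^'p^'n \<Rightarrow> real^'p^'m"
  by (rule bounded_bilinear_matrix_mult)

lemma inner_matrix: "inner A B = (\<Sum>i\<in>UNIV. \<Sum>j\<in>UNIV. A $ i $ j * B $ i $ j)" for A B :: "real^'n^'m"
  by (simp add: inner_vec_def)

lemma linear_transpose: "linear (transpose :: real^'n^'m \<Rightarrow> real^'m^'n)"
  by (auto intro!: linearI simp: transpose_def vec_eq_iff)

lemmas transpose_add = linear_add[OF linear_transpose]
  and transpose_diff = linear_diff[OF linear_transpose]
  and transpose_sum = linear_sum[OF linear_transpose]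
  and transpose_scaleR = linear_cmul[OF linear_transpose]
  and transpose_minus = linear_neg[OF linear_transpose]
  and transpose_zero = linear_0[OF linear_transpose]

lemma inner_transpose: "inner (transpose A) (transpose B) = inner A B" for A B :: "real^'n^'m"
  unfolding inner_matrix transpose_def by (simp, subst sum.swap, simp)

lemma norm_transpose: "norm (transpose A) = norm A" for A :: "real^'n^'m"
  by (simp add: norm_eq_sqrt_inner inner_transpose)

lemma inner_trace: "inner A B = trace (transpose A ** B)" for A B :: "real^'n^'m"
  unfolding inner_matrix trace_def transpose_def matrix_matrix_mult_def by (simp, subst sum.swap, simp)

lemma inner_mat_1: "inner (mat 1) A = trace A" for A :: "real^'n^'n"
  by (simp add: inner_trace)

lemma inner_mult_left: "inner (A ** B) C = inner B (transpose A ** C)" for A :: "real^'n^'m" and B :: "real^'p^'n"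
  by (simp add: inner_trace matrix_transpose_mul matrix_mul_assoc)

lemma inner_mult_right: "inner (A ** B) C = inner A (C ** transpose B)" for A :: "real^'n^'m" and B :: "real^'p^'n"
proof -
  have "inner (A ** B) C = inner (transpose B ** transpose A) (transpose C)"
    by (metis inner_transpose matrix_transpose_mul)
  also have "\<dots> = inner (transpose A) (transpose (C ** transpose B))"
    by (simp add: inner_mult_left matrix_transpose_mul)
  finally show ?thesis by (simp only: inner_transpose)
qed

lemma norm_matrix_mult_le: "norm (A ** B) \<le> norm A * norm B" for A :: "real^'n^'m" and B :: "real^'p^'n"
proof -
  have sq: "(norm C)\<^sup>2 = (\<Sum>i\<in>UNIV. (norm (C $ i))\<^sup>2)" for C :: "real^'a^'b"
    unfolding power2_norm_eq_inner by (simp add: inner_vec_def)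
  have "(norm (A ** B))\<^sup>2 = (\<Sum>i\<in>UNIV. \<Sum>j\<in>UNIV. ((A ** B) $ i $ j)\<^sup>2)"
    unfolding power2_norm_eq_inner unfolding inner_matrix power2_eq_square ..
  also have "\<dots> \<le> (\<Sum>i\<in>UNIV. \<Sum>j\<in>UNIV. (norm (A $ i))\<^sup>2 * (norm (transpose B $ j))\<^sup>2)"
  proof (intro sum_mono)
    fix i j
    have "(A ** B) $ i $ j = inner (A $ i) (transpose B $ j)"
      by (simp add: matrix_matrix_mult_def inner_vec_def transpose_def)
    hence "\<bar>(A ** B) $ i $ j\<bar> \<le> norm (A $ i) * norm (transpose B $ j)"
      using Cauchy_Schwarz_ineq2 by metis
    thus "((A ** B) $ i $ j)\<^sup>2 \<le> (norm (A $ i))\<^sup>2 * (norm (transpose B $ j))\<^sup>2"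
      by (metis abs_ge_zero power2_abs power_mono power_mult_distrib)
  qed
  also have "\<dots> = (norm A)\<^sup>2 * (norm (transpose B))\<^sup>2"
    by (simp add: sq sum_product)
  finally have "(norm (A ** B))\<^sup>2 \<le> (norm A * norm B)\<^sup>2"
    by (simp add: norm_transpose power_mult_distrib)
  thus ?thesis by (rule power2_le_imp_le) simp
qed

lemma outer_mult_vec: "outer u v *v x = inner v x *\<^sub>R u"
  by (simp add: outer_def matrix_vector_mult_def inner_vec_def vec_eq_iff sum_distrib_left mult_ac)

lemma inner_outer: "inner (outer u v) Q = inner u (Q *v v)"
  unfolding inner_matrix outer_def matrix_vector_mult_def inner_vec_def
  by (simp add: sum_distrib_left mult_ac)

lemma mult_outer: "A ** outer u v = outer (A *v u) v"
  by (simp add: outer_def matrix_vector_mult_def matrix_matrix_mult_def vec_eq_iff sum_distrib_left mult_ac)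

lemma transpose_outer: "transpose (outer u v) = outer v u"
  by (simp add: outer_def transpose_def vec_eq_iff)

lemma outer_scaleR_left: "outer (c *\<^sub>R u) v = c *\<^sub>R outer u v"
  by (simp add: outer_def vec_eq_iff)

lemma outer_mult_outer: "outer u v ** outer w z = inner v w *\<^sub>R outer u z"
  by (simp add: mult_outer outer_mult_vec outer_scaleR_left)

lemma trace_outer: "trace (outer u v) = inner u v"
  by (simp add: trace_def outer_def inner_vec_def)

lemma linear_trace: "linear (trace :: real^'n^'n \<Rightarrow> real)"
  by (auto intro!: linearI simp: trace_def sum.distrib sum_distrib_left)

section \<open>Orthonormal eigenbases and projectors onto their lowest vectors\<close>

lemma eigdec_orthonormal:
  fixes A :: "real^'n^'n"
  assumes "eigdec A phi lam" "i < CARD('n)" "j < CARD('n)"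
  shows "inner (phi i) (phi j) = (if i = j then 1 else 0)"
  using assms by (simp add: eigdec_def)

lemma eigdec_complete:
  fixes A :: "real^'n^'n"
  assumes ed: "eigdec A phi lam"
  shows "(\<Sum>i<CARD('n). outer (phi i) (phi i)) = mat 1"
proof -
  let ?n = "CARD('n)"
  note on = eigdec_orthonormal[OF ed]
  have inj: "inj_on phi {..<?n}"
  proof (rule inj_onI, rule ccontr)
    fix i j assume "i \<in> {..<?n}" "j \<in> {..<?n}" "phi i = phi j" "i \<noteq> j"
    thus False using on[of i i] on[of i j] by simp
  qed
  have "independent (phi ` {..<?n})"
  proof (rule pairwise_orthogonal_independent)
    show "pairwise orthogonal (phi ` {..<?n})"
      by (auto simp: pairwise_def orthogonal_def on)
    show "0 \<notin> phi ` {..<?n}" using on by fastforce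
  qed
  moreover have "card (phi ` {..<?n}) = ?n" using inj by (simp add: card_image)
  ultimately have sp: "span (phi ` {..<?n}) = UNIV"
    using card_ge_dim_independent[of "phi ` {..<?n}" UNIV] by auto
  have "(\<Sum>i<?n. outer (phi i) (phi i)) *v x = mat 1 *v x" for x
  proof (rule linear_eq_on_span[of "\<lambda>x. (\<Sum>i<?n. outer (phi i) (phi i)) *v x" "\<lambda>x. mat 1 *v x" "phi ` {..<?n}"])
    fix y assume "y \<in> phi ` {..<?n}"
    then obtain j where j: "j < ?n" "y = phi j" by auto
    have "(\<Sum>i<?n. outer (phi i) (phi i)) *v y = (\<Sum>i<?n. outer (phi i) (phi i) *v y)"
      by (rule linear_sum) (auto intro!: linearI simp: matrix_vector_mult_add_rdistrib scaleR_matrix_vector_assoc)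
    also have "\<dots> = (\<Sum>i<?n. if i = j then phi j else 0)"
      by (intro sum.cong) (auto simp: outer_mult_vec on j)
    finally show "(\<Sum>i<?n. outer (phi i) (phi i)) *v y = mat 1 *v y" using j by simp
  qed (auto simp: sp matrix_vector_mul_linear linear_id[unfolded id_def])
  thus ?thesis by (simp add: matrix_eq)
qed

lemma symm_inner: "symm A \<Longrightarrow> inner (A *v x) y = inner x (A *v y)"
  using transpose_matrix_vector[of A x] dot_lmul_matrix[of x A y] by (simp add: symm_def)

lemma eigdec_exists:
  fixes A :: "real^'n^'n"
  assumes A: "symm A"
  shows "\<exists>phi lam. eigdec A phi lam"
proof -
  have "selfadjoint_on inner (UNIV :: (real^'n) set) ((*v) A)"
  proof (rule selfadjoint_on.intro)
    show "bilinear (inner :: real^'n \<Rightarrow> _)"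
      by (auto simp: bilinear_def intro!: linearI simp: inner_add inner_left_distrib inner_right_distrib)
    show "inner (A *v x) y = inner x (A *v y)" for x y
      using A symm_inner by blast
  qed (auto simp: inner_commute matrix_vector_mul_linear)
  from spectral_theorem[OF this, unfolded dim_UNIV DIM_cart DIM_real mult_1_right]
  show ?thesis unfolding eigdec_def by (elim exE conjE, intro exI conjI) auto
qed

lemma eigdec_decomposition:
  fixes A :: "real^'n^'n"
  assumes ed: "eigdec A phi lam"
  shows "A = (\<Sum>i<CARD('n). lam i *\<^sub>R outer (phi i) (phi i))"
proof -
  have "A = A ** (\<Sum>i<CARD('n). outer (phi i) (phi i))" by (simp add: eigdec_complete[OF ed])
  also have "\<dots> = (\<Sum>i<CARD('n). lam i *\<^sub>R outer (phi i) (phi i))"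
    using ed by (auto simp: mm.sum_right mult_outer eigdec_def outer_scaleR_left intro!: sum.cong)
  finally show ?thesis .
qed

text \<open>\<open>PhiA\<close> picks one such matrix by choice; keeping the eigenbasis explicit
  allows statements that hold for every admissible choice.\<close>

definition eigproj :: "(nat \<Rightarrow> real^'n) \<Rightarrow> nat \<Rightarrow> real^'n^'n" where
  "eigproj phi N = (\<Sum>i<N. outer (phi i) (phi i))"

lemma eigproj_in_MN:
  fixes A :: "real^'n^'n"
  assumes ed: "eigdec A phi lam" and N: "N \<le> CARD('n)"
  shows "eigproj phi N \<in> MN N" and "A ** eigproj phi N = eigproj phi N ** A"
proof -
  note on = eigdec_orthonormal[OF ed]
  have "eigproj phi N ** eigproj phi N = (\<Sum>i<N. \<Sum>j<N. if j = i then outer (phi i) (phi i) else 0)"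
    unfolding eigproj_def mm.sum_left mm.sum_right
    using N by (intro sum.cong refl) (auto simp: outer_mult_outer on)
  hence idem: "eigproj phi N ** eigproj phi N = eigproj phi N" by (simp add: eigproj_def)
  have "trace (eigproj phi N) = (\<Sum>i<N. 1)"
    unfolding eigproj_def linear_sum[OF linear_trace] using N by (intro sum.cong) (auto simp: trace_outer on)
  moreover have sy: "transpose (eigproj phi N) = eigproj phi N"
    by (simp add: eigproj_def transpose_sum transpose_outer)
  ultimately show "eigproj phi N \<in> MN N" using idem by (simp add: MN_def symm_def)
  have AP: "A ** eigproj phi N = (\<Sum>i<N. lam i *\<^sub>R outer (phi i) (phi i))"
    using ed N unfolding eigproj_def mm.sum_right
    by (intro sum.cong) (auto simp: mult_outer eigdec_def outer_scaleR_left)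
  have At: "transpose A = A"
    by (subst (1 2) eigdec_decomposition[OF ed]) (simp add: transpose_sum transpose_scaleR transpose_outer)
  \<comment> \<open>A symmetric product of two symmetric matrices is a commuting product.\<close>
  have "transpose (A ** eigproj phi N) = A ** eigproj phi N"
    unfolding AP by (simp add: transpose_sum transpose_scaleR transpose_outer)
  thus "A ** eigproj phi N = eigproj phi N ** A" by (simp add: matrix_transpose_mul At sy)
qed

text \<open>An eigenbasis exists without any gap, so the choice in \<open>PhiA\<close> is never
  void, even where several projectors are eligible.\<close>

lemma PhiA_eigproj:
  fixes A :: "real^'n^'n"
  assumes "symm A"
  obtains phi lam where "eigdec A phi lam" "PhiA A N = eigproj phi N"
proof -
  have "\<exists>Q phi lam. eigdec A phi lam \<and> Q = (\<Sum>i<N. outer (phi i) (phi i))"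
    using eigdec_exists[OF assms] by blast
  from someI_ex[OF this] show ?thesis using that unfolding PhiA_def[symmetric] eigproj_def by blast
qed

lemma norm_MN_sq: "P \<in> MN N \<Longrightarrow> (norm P)\<^sup>2 = real N"
  by (simp add: power2_norm_eq_inner inner_trace MN_def symm_def)

lemma norm_MN_diff_sq:
  assumes "P \<in> MN N" "Q \<in> MN N"
  shows "(norm (Q - P))\<^sup>2 = 2 * (real N - inner P Q)"
proof -
  have "(norm (Q - P))\<^sup>2 = (norm Q)\<^sup>2 + (norm P)\<^sup>2 - 2 * inner P Q"
    by (simp add: power2_norm_eq_inner inner_diff_left inner_diff_right inner_commute)
  thus ?thesis using assms by (simp add: norm_MN_sq)
qed

text \<open>The weights of \<open>Q\<close> on the eigenvectors lie in \<open>[0,1]\<close> and add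
  up to \<open>N\<close>. A weight \<open>s\<close> missing from the lowest \<open>N\<close> levels
  reappears above the gap, at a cost of at least the gap times \<open>s\<close>, and
  \<open>2 * s\<close> is the squared distance.\<close>

lemma eigproj_gap:
  fixes A :: "real^'n^'n"
  assumes ed: "eigdec A phi lam" and N: "1 \<le> N" "N < CARD('n)" and Q: "Q \<in> MN N"
  shows "inner A (Q - eigproj phi N) \<ge> (lam N - lam (N - 1)) / 2 * (norm (Q - eigproj phi N))\<^sup>2"
proof -
  let ?n = "CARD('n)"
  define w where "w i = inner (phi i) (Q *v phi i)" for i
  note on = eigdec_orthonormal[OF ed]
  have Qsym: "inner x (Q *v y) = inner (Q *v x) y" for x y
    using Q symm_inner[of Q x y] by (simp add: MN_def)
  have w: "w i = (norm (Q *v phi i))\<^sup>2" for i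
  proof -
    have "Q *v phi i = Q *v (Q *v phi i)" using Q by (simp add: MN_def matrix_vector_mul_assoc)
    thus ?thesis unfolding w_def power2_norm_eq_inner using Qsym[of "phi i" "Q *v phi i"] by simp
  qed
  have w0: "w i \<ge> 0" for i by (simp add: w)
  have w1: "w i \<le> 1" if "i < ?n" for i
  proof -
    have n1: "norm (phi i) = 1" using on[OF that that] by (simp add: norm_eq_sqrt_inner)
    have "w i \<le> norm (phi i) * norm (Q *v phi i)" unfolding w_def by (rule norm_cauchy_schwarz)
    hence "(norm (Q *v phi i))\<^sup>2 \<le> norm (Q *v phi i)" by (simp add: n1 w)
    hence "norm (Q *v phi i) \<le> 1"
      using mult_strict_right_mono[of 1 "norm (Q *v phi i)" "norm (Q *v phi i)"]
      unfolding power2_eq_square by linarith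
    thus ?thesis by (simp add: w power_le_one)
  qed
  have split: "(\<Sum>i<?n. f i) = (\<Sum>i<N. f i) + (\<Sum>i=N..<?n. f i)" for f :: "nat \<Rightarrow> real"
    using N by (simp add: lessThan_atLeast0 sum.atLeastLessThan_concat)
  have tr: "(\<Sum>i<?n. w i) = real N"
  proof -
    have "(\<Sum>i<?n. w i) = inner (\<Sum>i<?n. outer (phi i) (phi i)) Q"
      by (simp add: inner_sum_left inner_outer w_def)
    also have "\<dots> = trace Q" by (simp add: eigdec_complete[OF ed] inner_mat_1)
    finally show ?thesis using Q by (simp add: MN_def)
  qed
  have PQ: "inner (eigproj phi N) Q = (\<Sum>i<N. w i)"
    by (simp add: eigproj_def inner_sum_left inner_outer w_def)
  have AQ: "inner A Q = (\<Sum>i<?n. lam i * w i)"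
    by (subst eigdec_decomposition[OF ed]) (simp add: inner_sum_left inner_outer w_def)
  have "inner A (eigproj phi N) = (\<Sum>i<N. inner (phi i) (A *v phi i))"
    by (simp add: eigproj_def inner_sum_right inner_outer inner_commute[of A])
  also have "\<dots> = (\<Sum>i<N. lam i)"
    using ed N on by (intro sum.cong) (auto simp: eigdec_def)
  finally have AP: "inner A (eigproj phi N) = (\<Sum>i<N. lam i)" .
  define s where "s = real N - (\<Sum>i<N. w i)"
  have s1: "s = (\<Sum>i<N. 1 - w i)" and s2: "s = (\<Sum>i=N..<?n. w i)"
    using tr split[of w] by (simp_all add: s_def sum_subtractf)
  have mono: "lam i \<le> lam j" if "i \<le> j" "j < ?n" for i j using ed that by (simp add: eigdec_def)
  have "(lam N - lam (N - 1)) * s = (\<Sum>i=N..<?n. lam N * w i) - (\<Sum>i<N. lam (N - 1) * (1 - w i))"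
    unfolding sum_distrib_left[symmetric] s1[symmetric] s2[symmetric] by (simp add: algebra_simps)
  also have "\<dots> \<le> (\<Sum>i=N..<?n. lam i * w i) - (\<Sum>i<N. lam i * (1 - w i))"
    using N w0 w1 by (intro diff_mono sum_mono mult_right_mono mono) auto
  also have "\<dots> = inner A (Q - eigproj phi N)"
    unfolding inner_diff_right AQ AP split by (simp add: algebra_simps sum_subtractf)
  moreover have "(norm (Q - eigproj phi N))\<^sup>2 = 2 * s"
    using norm_MN_diff_sq[OF eigproj_in_MN(1)[OF ed] Q] N by (simp add: PQ s_def)
  ultimately show ?thesis by simp
qed

section \<open>The manifold of projectors\<close>

text \<open>Multiplication of vectors is componentwise; this rule undoes the arithmetic simprocs
  that collect \<open>A + A\<close> into \<open>2 * A\<close>.\<close>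

lemma numeral_mult_matrix: "numeral w * A = numeral w *\<^sub>R A" for A :: "real^'n^'m"
proof -
  have "(numeral w :: real^'n^'m) $ i $ j = numeral w" for i j
    by (induction w) (simp_all add: numeral.simps)
  thus ?thesis by (simp add: vec_eq_iff)
qed

lemmas mm_simps = numeral_mult_matrix mm.add_left mm.add_right mm.diff_left mm.diff_right mm.minus_left mm.minus_right
  mm.scaleR_left mm.scaleR_right mm.zero_left mm.zero_right matrix_mul_assoc
  scaleR_add_right scaleR_diff_right

lemma MN_symm: "P \<in> MN N \<Longrightarrow> symm P" and MN_transpose: "P \<in> MN N \<Longrightarrow> transpose P = P"
  and MN_idem: "P \<in> MN N \<Longrightarrow> P ** P = P"
  by (auto simp: MN_def symm_def)

lemma MN_idem_right: "P \<in> MN N \<Longrightarrow> A ** P ** P = A ** P"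
  by (metis MN_idem matrix_mul_assoc)

lemma PiP_expand: "PiP P X = P ** X + X ** P - 2 *\<^sub>R (P ** X ** P)"
  by (simp add: PiP_def mm_simps)

lemma linear_PiP: "linear (PiP P)"
  by (auto intro!: linearI simp: PiP_expand mm_simps algebra_simps)

lemma symm_PiP: "symm P \<Longrightarrow> symm X \<Longrightarrow> symm (PiP P X)"
  by (simp add: symm_def PiP_expand transpose_add transpose_diff transpose_scaleR matrix_transpose_mul matrix_mul_assoc add.commute)

lemma symm_diff: "symm A \<Longrightarrow> symm B \<Longrightarrow> symm (A - B)"
  and symm_scaleR: "symm A \<Longrightarrow> symm (c *\<^sub>R A)"
  by (simp_all add: symm_def transpose_diff transpose_scaleR)

text \<open>With \<open>D = Q - P\<close>, idempotency of both projectors says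
  \<open>D ** D = D - P ** D - D ** P\<close>; multiplying by \<open>P\<close> on either side gives
  \<open>- P ** D ** P\<close>. So the normal part is quadratic with no remainder.\<close>

lemma MN_diff_normal_part:
  assumes "P \<in> MN N" "Q \<in> MN N"
  shows "(Q - P) - PiP P (Q - P) = (Q - P) ** (Q - P) - P ** ((Q - P) ** (Q - P)) - (Q - P) ** (Q - P) ** P"
  using assms by (simp add: PiP_expand mm_simps MN_idem MN_idem_right)

lemma MN_diff_normal_bound:
  assumes "P \<in> MN N" "Q \<in> MN N"
  shows "norm ((Q - P) - PiP P (Q - P)) \<le> (1 + 2 * sqrt N) * (norm (Q - P))\<^sup>2"
proof -
  let ?D = "(Q - P) ** (Q - P)"
  have P: "norm P = sqrt N" using norm_MN_sq[OF assms(1)] by (simp add: real_sqrt_unique)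
  have D: "norm ?D \<le> (norm (Q - P))\<^sup>2" using norm_matrix_mult_le[of "Q - P" "Q - P"] by (simp add: power2_eq_square)
  have "norm (?D - P ** ?D - ?D ** P) \<le> norm ?D + norm P * norm ?D + norm ?D * norm P"
    using norm_triangle_ineq4[of "?D - P ** ?D" "?D ** P"] norm_triangle_ineq4[of ?D "P ** ?D"]
      norm_matrix_mult_le[of P ?D] norm_matrix_mult_le[of ?D P] by linarith
  also have "\<dots> = (1 + 2 * sqrt N) * norm ?D" by (simp add: P algebra_simps)
  also have "\<dots> \<le> (1 + 2 * sqrt N) * (norm (Q - P))\<^sup>2" using D by (intro mult_left_mono) auto
  finally show ?thesis by (simp only: MN_diff_normal_part[OF assms])
qed

lemma inner_PiP:
  assumes "P \<in> MN N"
  shows "inner (PiP P X) Y = inner X (PiP P Y)"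
proof -
  have l: "inner (P ** A) B = inner A (P ** B)" and r: "inner (A ** P) B = inner A (B ** P)" for A B
    using MN_transpose[OF assms] inner_mult_left[of P A B] inner_mult_right[of A P B] by simp_all
  show ?thesis
    unfolding PiP_expand
    by (simp add: inner_add_left inner_add_right inner_diff_left inner_diff_right l r matrix_mul_assoc)
qed

lemma PiP_commuting:
  assumes "P \<in> MN N" "H ** P = P ** H"
  shows "PiP P H = 0"
proof -
  have "P ** H ** P = P ** H" using MN_idem[OF assms(1)] assms(2) by (metis matrix_mul_assoc)
  thus ?thesis by (simp add: PiP_expand assms(2) mm_simps)
qed

text \<open>A matrix commuting with \<open>P\<close> is orthogonal to the tangent space at
  \<open>P\<close> and sees only the normal part of \<open>Q - P\<close>; the first-order term
  disappears exactly, not just asymptotically.\<close>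

lemma inner_commuting_MN_diff:
  assumes P: "P \<in> MN N" and Q: "Q \<in> MN N" and H: "symm H" "H ** P = P ** H"
  shows "inner H (Q - P) = inner (H - 2 *\<^sub>R (H ** P)) ((Q - P) ** (Q - P))"
proof -
  let ?D = "(Q - P) ** (Q - P)"
  have "inner H (Q - P) = inner H ((Q - P) - PiP P (Q - P)) + inner (PiP P H) (Q - P)"
    unfolding inner_PiP[OF P] inner_diff_right[of H "Q - P" "PiP P (Q - P)"] by simp
  also have "\<dots> = inner H ?D - inner (P ** H) ?D - inner (H ** P) ?D"
    unfolding MN_diff_normal_part[OF P Q] PiP_commuting[OF P H(2)]
    by (simp add: inner_diff_right inner_mult_left[of P] inner_mult_right[of _ P] MN_transpose[OF P])
  finally show ?thesis by (simp add: H(2) inner_diff_left numeral_mult_matrix)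
qed

lemma tangentD:
  assumes "P \<in> MN N" "X \<in> tangent P"
  shows "symm X" "P ** X ** P = 0" "P ** X = X - X ** P" "PiP P X = X"
proof -
  show "symm X" and 1: "P ** X ** P = 0" using assms by (auto simp: tangent_def)
  have "(mat 1 - P) ** X ** (mat 1 - P) = 0" using assms by (simp add: tangent_def)
  hence 2: "X - X ** P - P ** X + P ** X ** P = 0" by (simp add: mm_simps algebra_simps)
  show "P ** X = X - X ** P" using 2 by (simp add: 1 algebra_simps)
  thus "PiP P X = X" unfolding PiP_expand 1 by simp
qed

lemma tangentI:
  assumes "P \<in> MN N" "symm X" "PiP P X = X"
  shows "X \<in> tangent P"
proof -
  have "P ** X ** P = P ** PiP P X ** P" by (simp add: assms(3))
  also have "\<dots> = 0" using assms(1) by (simp add: PiP_expand mm_simps MN_idem MN_idem_right)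
  finally have 1: "P ** X ** P = 0" .
  have "(mat 1 - P) ** X ** (mat 1 - P) = (mat 1 - P) ** PiP P X ** (mat 1 - P)" by (simp add: assms(3))
  also have "\<dots> = 0" using assms(1) by (simp add: PiP_expand mm_simps MN_idem MN_idem_right)
  finally show ?thesis using 1 assms(2) by (simp add: tangent_def)
qed

lemma PiP_idem: "P \<in> MN N \<Longrightarrow> PiP P (PiP P X) = PiP P X"
  by (simp add: PiP_expand mm_simps MN_idem MN_idem_right)

lemma PiP_in_tangent: "P \<in> MN N \<Longrightarrow> symm X \<Longrightarrow> PiP P X \<in> tangent P"
  by (intro tangentI) (auto simp: PiP_idem symm_PiP MN_symm)

lemma subspace_tangent: "subspace (tangent P)"
  unfolding tangent_def
  by (auto simp: subspace_def symm_def transpose_zero transpose_add transpose_scaleR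
      mm.add_left mm.add_right mm.scaleR_left mm.scaleR_right)

section \<open>The commutator operator \<open>Omega\<close> and first-order perturbation\<close>

lemma linear_comm: "linear (comm A)"
  by (auto intro!: linearI simp: comm_def mm_simps algebra_simps)

lemma linear_Omega: "linear (Omega P H)"
  unfolding Omega_def by (intro linear_compose_neg linear_compose[OF linear_comm linear_comm, unfolded o_def])

lemma norm_comm_le: "norm (comm A B) \<le> 2 * norm A * norm B"
  using norm_triangle_ineq4[of "A ** B" "B ** A"] norm_matrix_mult_le[of A B] norm_matrix_mult_le[of B A]
  unfolding comm_def by (simp add: mult.commute[of "norm B"])

text \<open>In the block splitting by \<open>P\<close>, the double commutator keeps off-diagonal
  blocks and kills diagonal ones; this is how the tangent projection enters commutator
  identities.\<close>

lemma comm_comm: "P \<in> MN N \<Longrightarrow> comm P (comm P X) = PiP P X"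
  by (simp add: comm_def PiP_expand mm_simps MN_idem MN_idem_right)

lemma Omega_in_tangent:
  assumes P: "P \<in> MN N" and "symm H" "symm X"
  shows "Omega P H X \<in> tangent P"
proof (rule tangentI[OF P])
  show "symm (Omega P H X)"
    using assms by (simp add: Omega_def comm_def symm_def transpose_minus transpose_diff matrix_transpose_mul
        MN_transpose mm_simps)
  show "PiP P (Omega P H X) = Omega P H X"
    using P by (simp add: Omega_def comm_def PiP_expand mm_simps MN_idem MN_idem_right)
qed

lemma inner_comm: "symm A \<Longrightarrow> inner (comm A B) C = inner B (comm A C)"
  by (simp add: comm_def inner_diff_left inner_diff_right inner_mult_left[of A] inner_mult_right[of _ A] symm_def)

text \<open>Commutation with a symmetric matrix is self-adjoint, and \<open>comm H\<close> and
  \<open>comm P\<close> commute as maps because \<open>H\<close> and \<open>P\<close> do.\<close>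

lemma inner_Omega:
  assumes "symm P" "symm H" "H ** P = P ** H"
  shows "inner (Omega P H X) Y = inner X (Omega P H Y)"
proof -
  have "comm H (comm P Y) = comm P (comm H Y)"
  proof -
    have "Y ** P ** H = Y ** H ** P" by (simp only: assms(3) flip: matrix_mul_assoc)
    thus ?thesis by (simp add: comm_def mm_simps assms(3))
  qed
  thus ?thesis using assms by (simp add: Omega_def inner_comm)
qed

text \<open>A tangent vector exchanges \<open>P\<close> with its complement,
  \<open>P ** X = X ** (mat 1 - P)\<close>, which lets the two factors \<open>X\<close> be brought
  together.\<close>

lemma Omega_quadratic:
  assumes P: "P \<in> MN N" and X: "X \<in> tangent P" and H: "symm H" "H ** P = P ** H"
  shows "inner X (Omega P H X) = 2 * inner (H - 2 *\<^sub>R (H ** P)) (X ** X)"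
proof -
  have Xt: "transpose X = X" using tangentD(1)[OF P X] by (simp add: symm_def)
  have l: "inner X (A ** X) = inner A (X ** X)" and r: "inner X (X ** A) = inner A (X ** X)" for A
    using inner_mult_right[of A X X] inner_mult_left[of X A X] Xt by (simp_all add: inner_commute)
  have XP: "P ** X = X - X ** P" "X ** P = X - P ** X" using tangentD(3)[OF P X] by simp_all
  have "Omega P H X = (P ** X) ** H + H ** (X ** P) - (P ** H) ** X - X ** (H ** P)"
    by (simp add: Omega_def comm_def mm_simps)
  also have "\<dots> = X ** H - X ** (P ** H) + (H ** X - (H ** P) ** X) - (P ** H) ** X - X ** (H ** P)"
    unfolding XP(1) by (subst XP(2)) (simp add: mm_simps)
  also have "inner X \<dots> = 2 * inner (H - 2 *\<^sub>R (H ** P)) (X ** X)"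
    by (simp add: inner_add_right inner_diff_right l r H(2) inner_diff_left numeral_mult_matrix)
  finally show ?thesis .
qed

text \<open>The removed part commutes with \<open>P\<close>, hence so does its commutator with
  \<open>H\<close>, and the outer commutator annihilates it.\<close>

lemma Omega_PiP:
  assumes P: "P \<in> MN N" and H: "H ** P = P ** H"
  shows "Omega P H (PiP P D) = Omega P H D"
proof -
  define W where "W = D - PiP P D"
  have W: "P ** W = W ** P" using P by (simp add: W_def PiP_expand mm_simps MN_idem MN_idem_right)
  have "P ** W ** H = W ** H ** P" unfolding W by (simp only: H flip: matrix_mul_assoc)
  moreover have "H ** W ** P = P ** H ** W"
    by (simp only: W[symmetric] flip: matrix_mul_assoc) (simp only: H matrix_mul_assoc)
  ultimately have "comm P (comm H W) = 0" by (simp add: comm_def mm_simps)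
  hence "Omega P H W = 0" by (simp add: Omega_def)
  thus ?thesis by (simp add: W_def linear_diff[OF linear_Omega])
qed

text \<open>Subtracting the two commutation relations expresses \<open>comm H (Q - P)\<close>
  through \<open>A - H\<close>. The identity is exact, and its last term is of second order once
  \<open>A\<close> is near \<open>H\<close> and \<open>Q\<close> near \<open>P\<close>.\<close>

lemma Omega_commuting_perturbation:
  assumes P: "P \<in> MN N" and H: "H ** P = P ** H" and A: "A ** Q = Q ** A"
  shows "Omega P H (Q - P) = - PiP P (A - H) - comm P (comm (Q - P) (A - H))"
proof -
  have "comm H (Q - P) = comm P (A - H) + comm (Q - P) (A - H)"
    using A H by (simp add: comm_def mm_simps)
  hence "Omega P H (Q - P) = - (comm P (comm P (A - H)) + comm P (comm (Q - P) (A - H)))"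
    by (simp add: Omega_def linear_add[OF linear_comm])
  thus ?thesis by (simp add: comm_comm[OF P])
qed

text \<open>The hypothesis concerns differences of projectors, the conclusion tangent vectors. Along
  \<open>R (P + t X)\<close> the differences divided by \<open>t\<close> converge to
  \<open>X\<close>, and homogeneity of degree 2 lets the bound survive the rescaling.\<close>

lemma tangent_quadratic_bound:
  fixes b :: "real^'n^'n \<Rightarrow> real" and R :: "real^'n^'n \<Rightarrow> real^'n^'n"
  assumes retr: "d > 0" "\<And>P X. P \<in> MN N \<Longrightarrow> symm X \<Longrightarrow> norm X < d \<Longrightarrow>
        R (P + X) \<in> MN N \<and> norm (R (P + X) - P - PiP P X) \<le> C * (norm X)\<^sup>2"
    and P: "P \<in> MN N" and X: "X \<in> tangent P"
    and b: "continuous_on UNIV b" "\<And>t D. b (t *\<^sub>R D) = t\<^sup>2 * b D"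
    and low: "e > 0" "\<And>Q. Q \<in> MN N \<Longrightarrow> norm (Q - P) < e \<Longrightarrow> c * (norm (Q - P))\<^sup>2 \<le> b (Q - P)"
  shows "c * (norm X)\<^sup>2 \<le> b X"
proof -
  define D where "D t = R (P + t *\<^sub>R X) - P" for t
  define g where "g t = (1 / t) *\<^sub>R D t" for t
  have ev: "\<forall>\<^sub>F t in at_right 0. 0 < t \<and> t * norm X < d"
  proof -
    have "((\<lambda>t. t * norm X) \<longlongrightarrow> 0 * norm X) (at_right 0)" by (intro tendsto_intros)
    hence "\<forall>\<^sub>F t in at_right 0. t * norm X < d" using retr(1) by (intro order_tendstoD(2)) auto
    thus ?thesis using eventually_at_right_less[of 0] by eventually_elim auto
  qed
  have D: "D t + P \<in> MN N \<and> norm (D t - t *\<^sub>R X) \<le> C * t\<^sup>2 * (norm X)\<^sup>2"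
    if "0 < t \<and> t * norm X < d" for t
    using retr(2)[OF P symm_scaleR[OF tangentD(1)[OF P X]], of t] that
    by (simp add: D_def linear_cmul[OF linear_PiP] tangentD(4)[OF P X] power_mult_distrib mult.assoc)
  have "((\<lambda>t. g t - X) \<longlongrightarrow> 0) (at_right 0)"
  proof (rule Lim_null_comparison)
    show "((\<lambda>t. C * t * (norm X)\<^sup>2) \<longlongrightarrow> 0) (at_right 0)" by (auto intro!: tendsto_eq_intros)
    show "\<forall>\<^sub>F t in at_right 0. norm (g t - X) \<le> C * t * (norm X)\<^sup>2"
      using ev
    proof eventually_elim
      case (elim t)
      have "g t - X = (1 / t) *\<^sub>R (D t - t *\<^sub>R X)" using elim by (simp add: g_def algebra_simps)
      hence "norm (g t - X) = norm (D t - t *\<^sub>R X) / t" using elim by simp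
      also have "\<dots> \<le> C * t\<^sup>2 * (norm X)\<^sup>2 / t" using D[OF elim] elim by (intro divide_right_mono) auto
      also have "\<dots> = C * t * (norm X)\<^sup>2" using elim by (simp add: power2_eq_square)
      finally show ?case .
    qed
  qed
  hence g: "(g \<longlongrightarrow> X) (at_right 0)" by (rule LIM_zero_cancel)
  have "((\<lambda>t. t *\<^sub>R g t) \<longlongrightarrow> 0 *\<^sub>R X) (at_right 0)" by (intro tendsto_intros g)
  hence "\<forall>\<^sub>F t in at_right 0. norm (t *\<^sub>R g t) < e"
    using low(1) by (intro order_tendstoD(2)[of _ 0] tendsto_norm_zero) auto
  hence ineq: "\<forall>\<^sub>F t in at_right 0. c * (norm (g t))\<^sup>2 \<le> b (g t)"
    using ev
  proof eventually_elim
    case (elim t)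
    have Dg: "D t = t *\<^sub>R g t" using elim by (simp add: g_def)
    have "c * (norm (D t))\<^sup>2 \<le> b (D t)" using low(2)[of "D t + P"] D[OF elim(2)] elim(1) by (simp add: Dg)
    hence "t\<^sup>2 * (c * (norm (g t))\<^sup>2) \<le> t\<^sup>2 * b (g t)" by (simp add: Dg b(2) power_mult_distrib mult_ac)
    thus ?case using elim(2) by simp
  qed
  have "isCont b X" using b(1) by (simp add: continuous_on_eq_continuous_at)
  hence "((\<lambda>t. b (g t)) \<longlongrightarrow> b X) (at_right 0)" using g by (rule isCont_tendsto_compose)
  moreover have "((\<lambda>t. c * (norm (g t))\<^sup>2) \<longlongrightarrow> c * (norm X)\<^sup>2) (at_right 0)" by (intro tendsto_intros g)
  ultimately show ?thesis using ineq by (intro tendsto_le[of "at_right (0::real)"]) auto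
qed

section \<open>Gradient and Hessian\<close>

text \<open>The Riesz representative: an explicit form of the gradient, which \<open>grad\<close>
  describes only by choice, that can be differentiated in turn.\<close>

definition riesz :: "('a::euclidean_space \<Rightarrow>\<^sub>L real) \<Rightarrow> 'a" where
  "riesz f = (\<Sum>b\<in>Basis. f b *\<^sub>R b)"

lemma inner_riesz: "inner (riesz f) x = f x"
proof -
  have "f x = f (\<Sum>b\<in>Basis. inner x b *\<^sub>R b)" by (simp add: euclidean_representation)
  also have "\<dots> = inner (riesz f) x"
    unfolding riesz_def blinfun.sum_right
    by (simp add: blinfun.scaleR_right inner_sum_left inner_commute[of x] mult.commute)
  finally show ?thesis by simp
qed

lemma grad_eq_riesz:
  assumes "(f has_derivative blinfun_apply f') (at x)"
  shows "grad f x = riesz f'"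
  unfolding grad_def
proof (rule some_equality)
  have "(\<lambda>h. inner h (riesz f')) = f'" by (simp add: fun_eq_iff inner_commute[of _ "riesz f'"] inner_riesz)
  thus 1: "GDERIV f x :> riesz f'" using assms by (simp add: gderiv_def)
  fix g assume "GDERIV f x :> g"
  with 1 have "(\<lambda>h. inner h g) = (\<lambda>h. inner h (riesz f'))"
    unfolding gderiv_def by (rule has_derivative_unique[rotated])
  hence "inner (g - riesz f') g = inner (g - riesz f') (riesz f')" by (rule fun_cong)
  hence "inner (g - riesz f') (g - riesz f') = 0" unfolding inner_diff_right by simp
  thus "g = riesz f'" by simp
qed

lemma symm_sym_part: "symm (sym_part A)"
  by (simp add: symm_def sym_part_def transpose_scaleR transpose_add add.commute)

lemma inner_sym_part: "symm X \<Longrightarrow> inner (sym_part A) X = inner A X"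
  using inner_transpose[of A X] by (simp add: symm_def sym_part_def inner_add_left)

lemma linear_sym_part: "linear sym_part"
  by (auto intro!: linearI simp: sym_part_def transpose_add transpose_scaleR algebra_simps)

text \<open>The choices behind \<open>grad\<close> and \<open>Hess\<close> are resolved here, and
  later arguments rest on these three facts. Directions in the last two are symmetric because only
  against those does the symmetric part pair like the full gradient.\<close>

lemma
  fixes E :: "real^'n^'n \<Rightarrow> real"
  assumes "C2 E"
  shows Hgrad_has_derivative: "(Hgrad E has_derivative Hess E P) (at P)"
    and inner_Hess_commute: "symm X \<Longrightarrow> symm Y \<Longrightarrow> inner (Hess E P X) Y = inner X (Hess E P Y)"
    and energy_expansion: "eps > 0 \<Longrightarrow> \<exists>d>0. \<forall>h. symm h \<and> norm h < d \<longrightarrow>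
      \<bar>E (P + h) - E P - inner (Hgrad E P) h - inner h (Hess E P h) / 2\<bar> \<le> eps * (norm h)\<^sup>2"
proof -
  obtain f' f'' where f': "\<And>x. (E has_derivative blinfun_apply (f' x)) (at x)"
    and f'': "\<And>x. (f' has_derivative blinfun_apply (f'' x)) (at x)"
    using assms unfolding C2_def by blast
  have g: "grad E = (\<lambda>x. riesz (f' x))" by (rule ext) (rule grad_eq_riesz[OF f'])
  have g': "(grad E has_derivative (\<lambda>X. riesz (f'' P X))) (at P)"
    unfolding g unfolding riesz_def
    by (intro has_derivative_sum has_derivative_scaleR_left
        bounded_linear.has_derivative[OF blinfun.bounded_linear_left] f'')
  have fr: "frechet_derivative (grad E) (at P) = (\<lambda>X. riesz (f'' P X))"
    using frechet_derivative_at[OF g'] by simp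
  have Hs: "Hess E P = (\<lambda>X. sym_part (riesz (f'' P X)))" by (simp add: fun_eq_iff Hess_def fr)
  have Hg: "Hgrad E = (\<lambda>P. sym_part (grad E P))" by (simp add: fun_eq_iff Hgrad_def)
  show "(Hgrad E has_derivative Hess E P) (at P)"
    unfolding Hs Hg
    by (rule bounded_linear.has_derivative[OF linear_sym_part[unfolded linear_conv_bounded_linear] g'])
  have in1: "inner (Hess E P X) Y = f'' P X Y" if "symm Y" for X Y
    using that by (simp add: Hs inner_sym_part inner_riesz)
  show "inner (Hess E P X) Y = inner X (Hess E P Y)" if "symm X" "symm Y" for X Y
    unfolding in1[OF that(2)] inner_commute[of X] in1[OF that(1)] by (rule second_derivative_symmetric[OF f' f''])
  have in2: "inner (Hgrad E P) Y = f' P Y" if "symm Y" for Y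
    using that by (simp add: Hgrad_def inner_sym_part inner_riesz g)
  assume "eps > 0"
  from taylor_second_order[OF f' f'' this, of P] show "\<exists>d>0. \<forall>h. symm h \<and> norm h < d \<longrightarrow>
      \<bar>E (P + h) - E P - inner (Hgrad E P) h - inner h (Hess E P h) / 2\<bar> \<le> eps * (norm h)\<^sup>2"
    by (auto simp: in1 in2 inner_commute[of _ "Hess E P _"])
qed

lemma symm_Hgrad: "symm (Hgrad E P)" and symm_Hess: "symm (Hess E P X)"
  by (simp_all add: Hgrad_def Hess_def symm_sym_part)

lemma eigproj_mult_vec:
  fixes A :: "real^'n^'n"
  assumes ed: "eigdec A phi lam" and "N \<le> CARD('n)" "j < CARD('n)"
  shows "eigproj phi N *v phi j = (if j < N then phi j else 0)"
proof -
  have "eigproj phi N *v phi j = (\<Sum>i<N. outer (phi i) (phi i) *v phi j)"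
    unfolding eigproj_def
    by (rule linear_sum) (auto intro!: linearI simp: matrix_vector_mult_add_rdistrib scaleR_matrix_vector_assoc)
  also have "\<dots> = (\<Sum>i<N. if i = j then phi j else 0)"
    using assms(2,3) by (intro sum.cong) (auto simp: outer_mult_vec eigdec_orthonormal[OF ed])
  finally show ?thesis by simp
qed

section \<open>Negligible functions\<close>

text \<open>Little-o of \<open>g\<close> along \<open>F\<close>, written without division so that
  points with \<open>g x = 0\<close>, such as the minimizer itself, need no exception.\<close>

definition negl :: "'a filter \<Rightarrow> ('a \<Rightarrow> real) \<Rightarrow> ('a \<Rightarrow> 'b::real_normed_vector) \<Rightarrow> bool" where
  "negl F g f \<longleftrightarrow> (\<forall>c>0. \<forall>\<^sub>F x in F. norm (f x) \<le> c * g x)"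

lemma negl_bound:
  assumes "negl F g h" "\<forall>\<^sub>F x in F. norm (f x) \<le> K * norm (h x)" "\<And>x. g x \<ge> 0"
  shows "negl F g f"
  unfolding negl_def
proof (intro allI impI)
  fix c :: real assume c: "c > 0"
  have "\<forall>\<^sub>F x in F. norm (h x) \<le> c / (\<bar>K\<bar> + 1) * g x"
    using assms(1) c unfolding negl_def by (metis abs_ge_zero add_nonneg_pos divide_pos_pos zero_less_one)
  thus "\<forall>\<^sub>F x in F. norm (f x) \<le> c * g x"
    using assms(2)
  proof eventually_elim
    case (elim x)
    have "norm (f x) \<le> (\<bar>K\<bar> + 1) * norm (h x)"
      by (rule order_trans[OF elim(2)]) (intro mult_right_mono, auto)
    also have "\<dots> \<le> (\<bar>K\<bar> + 1) * (c / (\<bar>K\<bar> + 1) * g x)" using elim(1) by (intro mult_left_mono) auto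
    also have "\<dots> = c * g x" by simp
    finally show ?case .
  qed
qed

lemma negl_cong: "negl F g f \<Longrightarrow> (\<And>x. f x = h x) \<Longrightarrow> negl F g h"
  by (simp add: negl_def)

lemma negl_add:
  assumes "negl F g f" "negl F g h"
  shows "negl F g (\<lambda>x. f x + h x)"
  unfolding negl_def
proof (intro allI impI)
  fix c :: real assume c: "c > 0"
  hence "\<forall>\<^sub>F x in F. norm (f x) \<le> c / 2 * g x" "\<forall>\<^sub>F x in F. norm (h x) \<le> c / 2 * g x"
    using assms unfolding negl_def by (metis half_gt_zero)+
  thus "\<forall>\<^sub>F x in F. norm (f x + h x) \<le> c * g x"
  proof eventually_elim
    case (elim x)
    thus ?case using norm_triangle_ineq[of "f x" "h x"] by simp
  qed
qed

lemma negl_linear: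
  assumes "bounded_linear A" "negl F g f" "\<And>x. g x \<ge> 0"
  shows "negl F g (\<lambda>x. A (f x))"
proof -
  obtain K where "\<And>x. norm (A x) \<le> K * norm x" using bounded_linear.bounded[OF assms(1)] by (metis mult.commute)
  thus ?thesis by (intro negl_bound[OF assms(2) _ assms(3)] always_eventually allI)
qed

lemma negl_quadratic:
  assumes "(g \<longlongrightarrow> 0) F" "\<forall>\<^sub>F x in F. norm (f x) \<le> K * (g x)\<^sup>2" "\<And>x. g x \<ge> 0"
  shows "negl F g f"
  unfolding negl_def
proof (intro allI impI)
  fix c :: real assume c: "c > 0"
  hence "\<forall>\<^sub>F x in F. g x < c / (\<bar>K\<bar> + 1)" using assms(1) by (intro order_tendstoD(2)) auto
  thus "\<forall>\<^sub>F x in F. norm (f x) \<le> c * g x" using assms(2)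
  proof eventually_elim
    case (elim x)
    have "K * (g x)\<^sup>2 \<le> (\<bar>K\<bar> + 1) * g x * g x"
      unfolding power2_eq_square mult.assoc using assms(3) by (intro mult_right_mono) auto
    also have "\<dots> \<le> c * g x"
      using elim(1) assms(3)[of x] by (intro mult_right_mono) (auto simp: field_simps)
    finally show ?case using elim(2) by simp
  qed
qed

lemma negl_imp_bound:
  assumes "negl F g f" shows "\<forall>\<^sub>F x in F. norm (f x) \<le> g x"
  using assms unfolding negl_def by (auto dest!: spec[of _ 1])

section \<open>The SCF iteration near the minimizer\<close>

text \<open>The Aufbau principle appears through \<open>commute\<close> and \<open>gap\<close>, a
  variational form free of eigenvectors that can be compared directly with perturbed
  matrices.\<close>

locale scf =
  fixes E :: "real^'n^'n \<Rightarrow> real" and R :: "real^'n^'n \<Rightarrow> real^'n^'n"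
    and N :: nat and Ps :: "real^'n^'n" and nu eta rad d C :: real
  assumes N: "1 \<le> N" "N < CARD('n)"
    and E: "C2 E"
    and Ps: "Ps \<in> MN N"
    and commute: "Hgrad E Ps ** Ps = Ps ** Hgrad E Ps"
    and nu: "nu > 0"
    and gap: "Q \<in> MN N \<Longrightarrow> nu / 2 * (norm (Q - Ps))\<^sup>2 \<le> inner (Hgrad E Ps) (Q - Ps)"
    and eta: "eta > 0"
    and rad: "rad > 0"
    and growth: "Q \<in> MN N \<Longrightarrow> norm (Q - Ps) < rad \<Longrightarrow> E Ps + eta * (norm (Q - Ps))\<^sup>2 \<le> E Q"
    and d: "d > 0"
    and retraction: "P \<in> MN N \<Longrightarrow> symm X \<Longrightarrow> norm X < d \<Longrightarrow>
        R (P + X) \<in> MN N \<and> norm (R (P + X) - P - PiP P X) \<le> C * (norm X)\<^sup>2"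
begin

abbreviation "T \<equiv> tangent Ps"
abbreviation "H \<equiv> Hgrad E Ps"
abbreviation "Om \<equiv> Omega Ps H"
abbreviation "K \<equiv> Kop E Ps"
abbreviation "J \<equiv> J_SCF E Ps"
abbreviation "PI \<equiv> PiP Ps"
abbreviation "B \<equiv> (\<lambda>X Y. inner X (Om Y))"

lemma Hess_bounded_linear: "bounded_linear (Hess E P)"
  using Hgrad_has_derivative[OF E] has_derivative_bounded_linear by blast

lemma tangent_add: "X \<in> T \<Longrightarrow> Y \<in> T \<Longrightarrow> X + Y \<in> T"
  and tangent_diff: "X \<in> T \<Longrightarrow> Y \<in> T \<Longrightarrow> X - Y \<in> T"
  and tangent_scaleR: "X \<in> T \<Longrightarrow> c *\<^sub>R X \<in> T"
  using subspace_tangent[of Ps] by (auto simp: subspace_add subspace_diff subspace_scale)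

lemma linear_K: "linear K"
  unfolding Kop_def
  using linear_compose[OF linear_compose[OF linear_PiP bounded_linear.linear[OF Hess_bounded_linear]] linear_PiP]
  by (simp add: o_def)

lemma K_in_T: "K X \<in> T"
  unfolding Kop_def by (rule PiP_in_tangent[OF Ps symm_Hess])

lemma quadratic_form_continuous: "continuous_on UNIV (\<lambda>D. inner A (D ** D))" for A :: "real^'n^'n"
  by (intro continuous_intros mm.continuous_on)

section \<open>Coercivity of \<open>Om\<close> and of the Riemannian Hessian
  \<open>Om + K\<close>\<close>

lemma Omega_coercive: "X \<in> T \<Longrightarrow> nu * (norm X)\<^sup>2 \<le> inner X (Om X)"
proof -
  assume X: "X \<in> T"
  have "nu / 2 * (norm X)\<^sup>2 \<le> inner (H - 2 *\<^sub>R (H ** Ps)) (X ** X)"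
  proof (rule tangent_quadratic_bound[OF d retraction Ps X quadratic_form_continuous _ rad])
    show "inner (H - 2 *\<^sub>R (H ** Ps)) (t *\<^sub>R D ** t *\<^sub>R D) = t\<^sup>2 * inner (H - 2 *\<^sub>R (H ** Ps)) (D ** D)" for t D
      by (simp add: mm.scaleR_left mm.scaleR_right power2_eq_square)
    show "nu / 2 * (norm (Q - Ps))\<^sup>2 \<le> inner (H - 2 *\<^sub>R (H ** Ps)) ((Q - Ps) ** (Q - Ps))"
      if "Q \<in> MN N" for Q
      using gap[OF that] by (simp only: inner_commuting_MN_diff[OF Ps that symm_Hgrad commute])
  qed
  thus ?thesis using Omega_quadratic[OF Ps X symm_Hgrad commute] by simp
qed

lemma inner_K: "X \<in> T \<Longrightarrow> Y \<in> T \<Longrightarrow> inner X (K Y) = inner X (Hess E Ps Y)"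
  by (simp add: Kop_def tangentD(4)[OF Ps] flip: inner_PiP[OF Ps])

lemma Hessian_coercive:
  assumes X: "X \<in> T"
  shows "eta * (norm X)\<^sup>2 \<le> inner X (Om X + K X)"
proof -
  \<comment> \<open>The second-order expansion of \<open>E\<close> along the manifold: pairing with
    the gradient does not vanish there and contributes the first summand, the curvature
    term.\<close>
  let ?b = "\<lambda>D. inner (H - 2 *\<^sub>R (H ** Ps)) (D ** D) + inner D (Hess E Ps D) / 2"
  obtain r where r: "r > 0" "\<And>h. symm h \<Longrightarrow> norm h < r \<Longrightarrow>
      \<bar>E (Ps + h) - E Ps - inner H h - inner h (Hess E Ps h) / 2\<bar> \<le> eta / 2 * (norm h)\<^sup>2"
    \<comment> \<open>Half of the growth constant absorbs the Taylor remainder; as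
      \<open>?b X\<close> is half the form of \<open>Om + K\<close>, the other half still yields
      \<open>eta\<close>.\<close>
    using energy_expansion[OF E, of "eta / 2" Ps] eta by auto
  have "eta / 2 * (norm X)\<^sup>2 \<le> ?b X"
  proof (rule tangent_quadratic_bound[OF d retraction Ps X, where e = "min r rad" and b = ?b])
    show "continuous_on UNIV ?b"
      by (rule continuous_on_add[OF quadratic_form_continuous])
         (intro continuous_intros linear_continuous_on[OF Hess_bounded_linear], simp)
    show "?b (t *\<^sub>R D) = t\<^sup>2 * ?b D" for t D
      by (simp add: mm.scaleR_left mm.scaleR_right power2_eq_square
          linear_cmul[OF bounded_linear.linear[OF Hess_bounded_linear]] algebra_simps)
    show "min r rad > 0" using r rad by simp
    fix Q assume Q: "Q \<in> MN N" and n: "norm (Q - Ps) < min r rad"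
    have "E Q - E Ps - inner H (Q - Ps) - inner (Q - Ps) (Hess E Ps (Q - Ps)) / 2 \<le> eta / 2 * (norm (Q - Ps))\<^sup>2"
      using r(2)[OF symm_diff[OF MN_symm[OF Q] MN_symm[OF Ps]]] n
      by (metis abs_le_D1 add_diff_cancel_left' diff_add_cancel add.commute min_less_iff_conj)
    thus "eta / 2 * (norm (Q - Ps))\<^sup>2 \<le> ?b (Q - Ps)"
      using growth[OF Q] n
      unfolding inner_commuting_MN_diff[OF Ps Q symm_Hgrad commute] by simp
  qed
  thus ?thesis
    using Omega_quadratic[OF Ps X symm_Hgrad commute] inner_K[OF X X] by (simp add: inner_add_right)
qed

lemma norm_le_Omega: "X \<in> T \<Longrightarrow> norm X \<le> norm (Om X) / nu"
proof -
  assume "X \<in> T"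
  have "nu * (norm X)\<^sup>2 \<le> norm X * norm (Om X)"
    using Omega_coercive[OF \<open>X \<in> T\<close>] norm_cauchy_schwarz[of X "Om X"] by linarith
  hence "norm X * (nu * norm X) \<le> norm X * norm (Om X)" by (simp add: power2_eq_square mult_ac)
  hence "nu * norm X \<le> norm (Om X)" by (cases "norm X = 0") auto
  thus ?thesis using nu by (simp add: field_simps)
qed

text \<open>Coercivity gives injectivity, and finite dimension does the rest. This makes the
  description by \<open>THE\<close> in \<open>Omega_inv\<close> determinate.\<close>

lemma Omega_bij: "bij_betw Om T T"
proof -
  have 0: "X = 0" if "X \<in> T" "Om X = 0" for X using norm_le_Omega[OF that(1)] that(2) by simp
  have inj: "inj_on Om T"
  proof (rule inj_onI)
    fix X Y assume "X \<in> T" "Y \<in> T" "Om X = Om Y"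
    thus "X = Y" using 0[of "X - Y"] by (simp add: tangent_diff linear_diff[OF linear_Omega])
  qed
  have sub: "Om ` T \<subseteq> T"
    using Omega_in_tangent[OF Ps symm_Hgrad] tangentD(1)[OF Ps] by blast
  have "dim (Om ` T) = dim T"
    using inj by (intro dim_image_eq[OF linear_Omega]) (simp add: span_eq_iff[THEN iffD2] subspace_tangent)
  hence "Om ` T = T"
    using sub by (intro subspace_dim_equal linear_subspace_image linear_Omega subspace_tangent) auto
  thus ?thesis using inj by (simp add: bij_betw_def)
qed

lemma Omega_inv: "Y \<in> T \<Longrightarrow> Omega_inv Ps H Y \<in> T \<and> Om (Omega_inv Ps H Y) = Y"
proof -
  assume "Y \<in> T"
  hence "\<exists>!X. X \<in> T \<and> Om X = Y"
    using Omega_bij by (auto simp: bij_betw_def inj_on_def) (metis imageE)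
  thus ?thesis unfolding Omega_inv_def by (rule theI')
qed

lemma Omega_inject: "X \<in> T \<Longrightarrow> Y \<in> T \<Longrightarrow> Om X = Om Y \<Longrightarrow> X = Y"
  using Omega_bij by (meson bij_betw_imp_inj_on inj_onD)

lemma J_in_T: "X \<in> T \<Longrightarrow> J X \<in> T"
  unfolding J_SCF_def using Omega_inv[OF K_in_T] tangent_add by blast

lemma Omega_J: "Om (J X) = Om X + K X"
  unfolding J_SCF_def by (simp add: linear_add[OF linear_Omega] Omega_inv[OF K_in_T])

lemma linear_J: "linear J"
proof (rule linearI)
  have add: "Omega_inv Ps H (Y + Z) = Omega_inv Ps H Y + Omega_inv Ps H Z" if "Y \<in> T" "Z \<in> T" for Y Z
    using that by - (rule Omega_inject, simp_all add: Omega_inv tangent_add linear_add[OF linear_Omega])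
  have scale: "Omega_inv Ps H (c *\<^sub>R Y) = c *\<^sub>R Omega_inv Ps H Y" if "Y \<in> T" for c Y
    using that by - (rule Omega_inject, simp_all add: Omega_inv tangent_scaleR linear_cmul[OF linear_Omega])
  show "J (X + Y) = J X + J Y" for X Y
    by (simp add: J_SCF_def linear_add[OF linear_K] add K_in_T)
  show "J (c *\<^sub>R X) = c *\<^sub>R J X" for c X
    by (simp add: J_SCF_def linear_cmul[OF linear_K] scale K_in_T scaleR_add_right)
qed

lemma B_J: "X \<in> T \<Longrightarrow> Y \<in> T \<Longrightarrow> B X (J Y) = inner X (Om Y + K Y)"
  by (simp add: Omega_J)

lemma B_commute: "B X Y = B Y X"
  using inner_Omega[OF MN_symm[OF Ps] symm_Hgrad commute, of Y X] by (simp add: inner_commute)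

text \<open>\<open>J\<close> need not be symmetric for the Frobenius product. In the
  \<open>Om\<close> product its inverse cancels, leaving the form of \<open>Om + K\<close>, which
  inherits symmetry from the second derivative.\<close>

lemma selfadjoint: "selfadjoint_on B T (\<lambda>X. X - beta *\<^sub>R J X)"
proof (rule selfadjoint_on.intro)
  show "bilinear B"
    by (auto simp: bilinear_def inner_add_left inner_add_right linear_add[OF linear_Omega]
        linear_cmul[OF linear_Omega] intro!: linearI)
  show "linear (\<lambda>X. X - beta *\<^sub>R J X)"
    by (rule linear_compose_sub[OF linear_id[unfolded id_def] linear_compose_scale_right[OF linear_J]])
  show "subspace T" by (rule subspace_tangent)
  fix X assume X: "X \<in> T"
  show "X - beta *\<^sub>R J X \<in> T" by (intro tangent_diff tangent_scaleR J_in_T X)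
  show "0 < B X X" if "X \<noteq> 0" using Omega_coercive[OF X] nu that
mult_pos_pos[OF nu, of "(norm X)\<^sup>2"]
    by (meson less_le_trans zero_less_norm_iff zero_less_power)
  fix Y assume Y: "Y \<in> T"
  show "B X Y = B Y X" by (rule B_commute)
  have "inner X (K Y) = inner Y (K X)"
    unfolding inner_K[OF X Y] inner_K[OF Y X]
    using inner_Hess_commute[OF E tangentD(1)[OF Ps X] tangentD(1)[OF Ps Y], of Ps]
      inner_commute[of Y "Hess E Ps X"] by simp
  hence "B (J X) Y = B X (J Y)"
    unfolding B_commute[of "J X" Y] B_J[OF X Y] B_J[OF Y X] inner_add_right B_commute[of X Y] by simp
  thus "B (X - beta *\<^sub>R J X) Y = B X (Y - beta *\<^sub>R J Y)"
    by (simp add: inner_diff_left inner_diff_right linear_diff[OF linear_Omega] linear_cmul[OF linear_Omega])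
qed

end

text \<open>\<open>eigproj phi N\<close> minimizes the pairing with \<open>A\<close>, and
  \<open>Ps\<close> the pairing with \<open>H\<close> with a quadratic margin; adding both
  comparisons leaves only \<open>A - H\<close>. The gap is one of \<open>H\<close>, so any
  eigenbasis of \<open>A\<close> is covered.\<close>

lemma eigproj_Lipschitz:
  fixes A H :: "real^'n^'n"
  assumes ed: "eigdec A phi lam" and N: "1 \<le> N" "N < CARD('n)"
    and Ps: "Ps \<in> MN N" and nu: "nu > 0"
    and gap: "\<And>Q. Q \<in> MN N \<Longrightarrow> nu / 2 * (norm (Q - Ps))\<^sup>2 \<le> inner H (Q - Ps)"
  shows "norm (eigproj phi N - Ps) \<le> 2 / nu * norm (A - H)"
proof -
  let ?Q = "eigproj phi N"
  have Q: "?Q \<in> MN N" using eigproj_in_MN(1)[OF ed] N by simp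
  have "lam (N - 1) \<le> lam N" using ed N by (simp add: eigdec_def)
  hence "0 \<le> (lam N - lam (N - 1)) / 2 * (norm (Ps - ?Q))\<^sup>2" by simp
  also have "\<dots> \<le> inner A (Ps - ?Q)" by (rule eigproj_gap[OF ed N Ps])
  finally have "nu / 2 * (norm (?Q - Ps))\<^sup>2 \<le> - inner (A - H) (?Q - Ps)"
    using gap[OF Q] by (simp add: inner_diff_left inner_diff_right)
  also have "\<dots> \<le> norm (A - H) * norm (?Q - Ps)"
    using Cauchy_Schwarz_ineq2[of "A - H" "?Q - Ps"] by linarith
  finally have "nu / 2 * norm (?Q - Ps) * norm (?Q - Ps) \<le> norm (A - H) * norm (?Q - Ps)"
    by (simp add: power2_eq_square mult_ac)
  hence "nu / 2 * norm (?Q - Ps) \<le> norm (A - H)"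
    by (cases "norm (?Q - Ps) = 0") auto
  thus ?thesis using nu by (simp add: field_simps)
qed

text \<open>If the two eigenvalues at the gap coincided, exchanging their eigenvectors would give a
  second spectral projector at distance at least 1 from the first, although both are close to \<open>Ps\<close>.\<close>

lemma aufbau_gap_nearby:
  fixes A H :: "real^'n^'n"
  assumes A: "symm A" and N: "1 \<le> N" "N < CARD('n)"
    and Ps: "Ps \<in> MN N" and nu: "nu > 0"
    and gap: "\<And>Q. Q \<in> MN N \<Longrightarrow> nu / 2 * (norm (Q - Ps))\<^sup>2 \<le> inner H (Q - Ps)"
    and near: "norm (A - H) < nu / 4"
  shows "aufbau_gap A N"
proof -
  obtain phi lam where ed: "eigdec A phi lam" using eigdec_exists[OF A] by blast
  have "lam (N - 1) \<noteq> lam N"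
  proof
    assume eq: "lam (N - 1) = lam N"
    define u where "u = phi (N - 1)"
    define psi where "psi = phi(N - 1 := phi N, N := phi (N - 1))"
    have ed': "eigdec A psi lam"
      using ed N eq unfolding eigdec_def psi_def by auto
    have u1: "inner u u = 1" using eigdec_orthonormal[OF ed, of "N - 1" "N - 1"] N by (simp add: u_def)
    have "eigproj phi N *v u = u" using eigproj_mult_vec[OF ed, of N "N - 1"] N by (simp add: u_def)
    moreover have "eigproj psi N *v u = 0" using eigproj_mult_vec[OF ed', of N N] N by (simp add: u_def psi_def)
    ultimately have "inner (outer u u) (eigproj phi N - eigproj psi N) = 1"
      by (simp add: inner_outer matrix_vector_mult_diff_rdistrib u1)
    moreover have "norm (outer u u) = 1"
      by (simp add: norm_eq_sqrt_inner inner_outer outer_mult_vec u1)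
    ultimately have "1 \<le> norm (eigproj phi N - eigproj psi N)"
      using norm_cauchy_schwarz[of "outer u u" "eigproj phi N - eigproj psi N"] by simp
    also have "\<dots> \<le> norm (eigproj phi N - Ps) + norm (eigproj psi N - Ps)"
      using norm_triangle_ineq4[of "eigproj phi N - Ps" "eigproj psi N - Ps"] by simp
    also have "\<dots> \<le> 2 / nu * norm (A - H) + 2 / nu * norm (A - H)"
      by (intro add_mono eigproj_Lipschitz[OF ed N Ps nu gap] eigproj_Lipschitz[OF ed' N Ps nu gap])
    \<comment> \<open>The radius \<open>nu / 4\<close> is what two Lipschitz bounds with constant
      \<open>2 / nu\<close> allow.\<close>
    also have "\<dots> < 1" using near nu by (simp add: field_simps)
    finally show False by simp
  qed
  moreover have "lam (N - 1) \<le> lam N" using ed N by (simp add: eigdec_def)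
  ultimately show ?thesis using ed N unfolding aufbau_gap_def by (metis order_less_le)
qed

context scf
begin

text \<open>An occupied vector and an empty one both exist, and their symmetrized outer product is
  tangent. This makes the spectral radius a maximum over a nonempty set.\<close>

lemma T_nontrivial: "T \<noteq> {0}"
proof -
  obtain phi lam where ed: "eigdec H phi lam" using eigdec_exists[OF symm_Hgrad] by blast
  have "norm (eigproj phi N - Ps) \<le> 2 / nu * norm (H - H)"
    by (rule eigproj_Lipschitz[OF ed N Ps nu gap])
  hence P: "Ps = eigproj phi N" by simp
  define u v where "u = phi 0" and "v = phi N"
  have Pu: "Ps *v u = u" and Pv: "Ps *v v = 0"
    using eigproj_mult_vec[OF ed, of N 0] eigproj_mult_vec[OF ed, of N N] N by (simp_all add: P u_def v_def)
  have on: "inner u u = 1" "inner v v = 1" "inner u v = 0"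
    using eigdec_orthonormal[OF ed] N by (auto simp: u_def v_def)
  define X where "X = outer u v + outer v u"
  have lo: "Ps ** outer u v = outer u v" "Ps ** outer v u = 0"
    by (simp_all add: mult_outer Pu Pv) (simp add: outer_def vec_eq_iff)
  have ro: "outer v u ** Ps = outer v u" "outer u v ** Ps = 0"
    using arg_cong[OF lo(1), of transpose] arg_cong[OF lo(2), of transpose]
    by (simp_all add: matrix_transpose_mul transpose_outer transpose_zero MN_transpose[OF Ps])
  have "X \<in> T"
  proof (rule tangentI[OF Ps])
    show "symm X" by (simp add: X_def symm_def transpose_add transpose_outer add.commute)
    show "PI X = X" by (simp add: X_def PiP_expand mm.add_left mm.add_right lo ro)
  qed
  moreover have "X *v v = u"
    by (simp add: X_def matrix_vector_mult_add_rdistrib outer_mult_vec on)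
  hence "X \<noteq> 0" using on(1) by auto
  ultimately show ?thesis by auto
qed

text \<open>The radius is attained at a real eigenpair, so \<open>mu\<close> is 1 minus
  \<open>beta\<close> times the Rayleigh quotient \<open>t / s\<close> of \<open>J\<close>.
  Coercivity makes that quotient positive, and it is at most \<open>M / nu\<close>; hence the
  threshold \<open>nu / M\<close>, below which \<open>mu\<close> also stays positive.\<close>

lemma spectral_radius_less_1:
  "\<exists>beta0>0. \<forall>beta. 0 < beta \<and> beta < beta0 \<longrightarrow> op_spectral_radius T (\<lambda>X. X - beta *\<^sub>R J X) < 1"
proof -
  have "bounded_linear (\<lambda>X. Om X + K X)"
    using linear_compose_add[OF linear_Omega linear_K] by (simp add: linear_conv_bounded_linear)
  then obtain M where M: "M > 0" "\<And>X. norm (Om X + K X) \<le> norm X * M"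
    using bounded_linear.pos_bounded by blast
  show ?thesis
  proof (intro exI[of _ "nu / M"] conjI allI impI)
    show "nu / M > 0" using nu M by simp
    fix beta assume beta: "0 < beta \<and> beta < nu / M"
    obtain X mu where X: "X \<in> T" "X \<noteq> 0" "X - beta *\<^sub>R J X = mu *\<^sub>R X"
      and r: "op_spectral_radius T (\<lambda>X. X - beta *\<^sub>R J X) = \<bar>mu\<bar>"
      using selfadjoint_on.spectral_radius(1)[OF selfadjoint T_nontrivial] by blast
    define s where "s = B X X"
    define t where "t = inner X (Om X + K X)"
    have n2: "(norm X)\<^sup>2 > 0" using X by simp
    have s: "nu * (norm X)\<^sup>2 \<le> s" unfolding s_def by (rule Omega_coercive[OF X(1)])
    have s0: "s > 0" using s mult_pos_pos[OF nu n2] by linarith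
    have t: "eta * (norm X)\<^sup>2 \<le> t" unfolding t_def by (rule Hessian_coercive[OF X(1)])
    have t0: "t > 0" using t mult_pos_pos[OF eta n2] by linarith
    have "t \<le> norm X * (norm X * M)"
      unfolding t_def using norm_cauchy_schwarz[of X "Om X + K X"] mult_left_mono[OF M(2)[of X] norm_ge_zero[of X]]
      by linarith
    hence tM: "t \<le> M * (norm X)\<^sup>2" by (simp add: power2_eq_square mult_ac)
    have "B X (X - beta *\<^sub>R J X) = s - beta * t"
      by (simp add: linear_diff[OF linear_Omega] linear_cmul[OF linear_Omega] Omega_J inner_diff_right s_def t_def)
    hence mu: "mu * s = s - beta * t" unfolding X(3) by (simp add: linear_cmul[OF linear_Omega] s_def)
    have "beta * t \<le> beta * (M * (norm X)\<^sup>2)" using tM beta by (intro mult_left_mono) auto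
    also have "\<dots> < nu * (norm X)\<^sup>2" using beta M(1) n2 by (simp add: pos_less_divide_eq)
    finally have "beta * t < s" using s by simp
    hence "mu * s > 0" using mu by simp
    moreover have "mu * s < 1 * s" using mu beta t0 by simp
    ultimately have "0 < mu" "mu < 1" using s0 by (simp_all add: zero_less_mult_iff mult_less_cancel_right)
    thus "op_spectral_radius T (\<lambda>X. X - beta *\<^sub>R J X) < 1" using r by simp
  qed
qed

section \<open>First-order expansion of the iteration map\<close>

definition F :: "real \<Rightarrow> real^'n^'n \<Rightarrow> real^'n^'n" where
  "F beta P = R (P + beta *\<^sub>R PiP P (Phi E N P - P))"

lemma iter_eq_funpow: "iter R E N beta P k = (F beta ^^ k) P"
  by (induction k) (simp_all add: F_def Let_def)

lemma Phi_eigproj: obtains phi lam where "eigdec (Hgrad E P) phi lam" "Phi E N P = eigproj phi N"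
  using PhiA_eigproj[OF symm_Hgrad] unfolding Phi_def by metis

text \<open>Valid at every \<open>P\<close>, with or without a gap there, since any eigenbasis
  picked by the choice will do. That the iterates stay where the gap is open is shown
  separately.\<close>

lemma Phi_in_MN: "Phi E N P \<in> MN N"
  and Phi_commute: "Hgrad E P ** Phi E N P = Phi E N P ** Hgrad E P"
  and Phi_Lipschitz: "norm (Phi E N P - Ps) \<le> 2 / nu * norm (Hgrad E P - H)"
proof -
  obtain phi lam where ed: "eigdec (Hgrad E P) phi lam" and Phi: "Phi E N P = eigproj phi N"
    by (rule Phi_eigproj)
  show "Phi E N P \<in> MN N" "Hgrad E P ** Phi E N P = Phi E N P ** Hgrad E P"
    using eigproj_in_MN[OF ed] N by (simp_all add: Phi)
  show "norm (Phi E N P - Ps) \<le> 2 / nu * norm (Hgrad E P - H)"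
    unfolding Phi by (rule eigproj_Lipschitz[OF ed N Ps nu gap])
qed

lemma Hgrad_continuous: "e > 0 \<Longrightarrow> \<exists>d>0. \<forall>P. norm (P - Ps) < d \<longrightarrow> norm (Hgrad E P - H) < e"
  using has_derivative_continuous[OF Hgrad_has_derivative[OF E], of Ps] 
  unfolding continuous_at_eps_delta dist_norm by blast

lemma aufbau_gap_near: "\<exists>d>0. \<forall>P. norm (P - Ps) < d \<longrightarrow> aufbau_gap (Hgrad E P) N"
  using Hgrad_continuous[of "nu / 4"] nu aufbau_gap_nearby[OF symm_Hgrad N Ps nu gap] by (metis zero_less_divide_iff zero_less_numeral)

text \<open>Neighbourhoods within the manifold, with \<open>Ps\<close> itself included, so that
  eventual statements become uniform ones on a ball.\<close>

abbreviation "Fil \<equiv> inf (nhds Ps) (principal (MN N))"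
abbreviation "dst \<equiv> (\<lambda>P. norm (P - Ps))"

lemma eventually_Fil: "eventually Q Fil \<longleftrightarrow> (\<exists>d>0. \<forall>P\<in>MN N. norm (P - Ps) < d \<longrightarrow> Q P)"
  unfolding eventually_inf_principal eventually_nhds_metric dist_norm by blast

lemma dst_tendsto: "(dst \<longlongrightarrow> 0) Fil"
proof -
  have "((\<lambda>P. norm (P - Ps)) \<longlongrightarrow> norm (Ps - Ps)) (nhds Ps)"
    by (intro tendsto_intros filterlim_ident)
  thus ?thesis by (auto intro: tendsto_mono[OF inf_le1])
qed

lemma MN_Fil: "\<forall>\<^sub>F P in Fil. P \<in> MN N"
  by (auto simp: eventually_inf_principal)

lemma negl_projection: "negl Fil dst (\<lambda>P. (P - Ps) - PI (P - Ps))"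
proof (rule negl_quadratic[OF dst_tendsto])
  show "\<forall>\<^sub>F P in Fil. norm ((P - Ps) - PI (P - Ps)) \<le> (1 + 2 * sqrt N) * (dst P)\<^sup>2"
    using MN_Fil by eventually_elim (rule MN_diff_normal_bound[OF Ps])
qed simp

lemma negl_Hgrad: "negl Fil dst (\<lambda>P. (Hgrad E P - H) - Hess E Ps (P - Ps))"
  unfolding negl_def
proof (intro allI impI)
  fix c :: real assume "c > 0"
  then obtain r where "r > 0" "\<forall>P. norm (P - Ps) < r \<longrightarrow>
      norm (Hgrad E P - H - Hess E Ps (P - Ps)) \<le> c * norm (P - Ps)"
    using Hgrad_has_derivative[OF E, of Ps] unfolding has_derivative_at_alt by blast
  thus "\<forall>\<^sub>F P in Fil. norm (Hgrad E P - H - Hess E Ps (P - Ps)) \<le> c * dst P"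
    unfolding eventually_Fil by blast
qed

lemma Hgrad_Lipschitz: "\<exists>c\<ge>0. \<forall>\<^sub>F P in Fil. norm (Hgrad E P - H) \<le> c * dst P"
proof -
  obtain M where M: "M > 0" "\<And>X. norm (Hess E Ps X) \<le> norm X * M"
    using bounded_linear.pos_bounded[OF Hess_bounded_linear] by blast
  have "\<forall>\<^sub>F P in Fil. norm (Hgrad E P - H) \<le> (M + 1) * dst P"
    using negl_imp_bound[OF negl_Hgrad]
  proof eventually_elim
    case (elim P)
    have "norm (Hgrad E P - H) \<le> norm (Hgrad E P - H - Hess E Ps (P - Ps)) + norm (Hess E Ps (P - Ps))"
      by (metis diff_add_cancel norm_triangle_ineq)
    thus ?case using elim M(2)[of "P - Ps"] by (simp add: algebra_simps)
  qed
  thus ?thesis using M(1) by (intro exI[of _ "M + 1"]) auto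
qed

lemma Phi_bound: "\<exists>c\<ge>0. \<forall>\<^sub>F P in Fil. norm (Phi E N P - Ps) \<le> c * dst P"
proof -
  obtain c where c: "c \<ge> 0" "\<forall>\<^sub>F P in Fil. norm (Hgrad E P - H) \<le> c * dst P" using Hgrad_Lipschitz by blast
  have "\<forall>\<^sub>F P in Fil. norm (Phi E N P - Ps) \<le> (2 / nu * c) * dst P"
    using c(2)
  proof eventually_elim
    case (elim P)
    have "2 / nu * norm (Hgrad E P - H) \<le> 2 / nu * (c * dst P)"
      using elim nu by (intro mult_left_mono) auto
    thus ?case using Phi_Lipschitz[of P] by (simp add: mult.assoc)
  qed
  thus ?thesis using c(1) nu by (intro exI[of _ "2 / nu * c"]) auto
qed

lemma PI_bounded_linear: "bounded_linear PI"
  using linear_PiP by (simp add: linear_conv_bounded_linear)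

lemma MN_diff_symm: "P \<in> MN N \<Longrightarrow> Q \<in> MN N \<Longrightarrow> symm (P - Q)"
  by (intro symm_diff MN_symm)

text \<open>First-order perturbation theory: \<open>Phi\<close> has derivative \<open>1 - J = - Omega\<^sup>-\<^sup>1 K\<close> at \<open>Ps\<close>.\<close>

lemma negl_Phi: "negl Fil dst (\<lambda>P. Phi E N P - P + J (PI (P - Ps)))"
proof -
  define X where "X P = PI (P - Ps)" for P
  define D where "D P = Phi E N P - Ps" for P
  define dH where "dH P = Hgrad E P - H" for P
  \<comment> \<open>\<open>W\<close> is the residual of the linearized equation and \<open>V\<close>
    the deviation of the tangent part of \<open>Phi\<close> from its prediction;
    \<open>Om V = W\<close>, so estimating \<open>W\<close> is enough.\<close>
  define W where "W P = Om (PI (D P)) + K (X P)" for P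
  define V where "V P = PI (D P) + J (X P) - X P" for P
  obtain c1 where c1: "c1 \<ge> 0" "\<forall>\<^sub>F P in Fil. norm (dH P) \<le> c1 * dst P"
    using Hgrad_Lipschitz unfolding dH_def by blast
  obtain c2 where c2: "c2 \<ge> 0" "\<forall>\<^sub>F P in Fil. norm (D P) \<le> c2 * dst P"
    using Phi_bound unfolding D_def by blast
  have quad: "negl Fil dst (\<lambda>P. comm Ps (comm (D P) (dH P)))"
  proof (rule negl_quadratic[OF dst_tendsto])
    show "\<forall>\<^sub>F P in Fil. norm (comm Ps (comm (D P) (dH P))) \<le> (2 * norm Ps * (2 * (c2 * c1))) * (dst P)\<^sup>2"
      using c1(2) c2(2)
    proof eventually_elim
      case (elim P)
      have "norm (D P) * norm (dH P) \<le> (c2 * dst P) * (c1 * dst P)"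
        using elim c2(1) by (intro mult_mono) auto
      hence "norm (comm (D P) (dH P)) \<le> 2 * ((c2 * dst P) * (c1 * dst P))"
        using norm_comm_le[of "D P" "dH P"] by simp
      hence "2 * norm Ps * norm (comm (D P) (dH P)) \<le> 2 * norm Ps * (2 * ((c2 * dst P) * (c1 * dst P)))"
        by (intro mult_left_mono) auto
      thus ?case using norm_comm_le[of Ps "comm (D P) (dH P)"] by (simp add: power2_eq_square mult_ac)
    qed
  qed simp
  \<comment> \<open>Three errors: the Taylor remainder of the gradient, the normal part of
    \<open>P - Ps\<close> inside the Hessian, and a commutator of two first-order factors.\<close>
  have W_eq: "W P = - PI (dH P - Hess E Ps (P - Ps)) - PI (Hess E Ps ((P - Ps) - X P)) - comm Ps (comm (D P) (dH P))" for P
  proof -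
    have "Om (PI (D P)) = - PI (dH P) - comm Ps (comm (D P) (dH P))"
      unfolding Omega_PiP[OF Ps commute] D_def dH_def
      by (rule Omega_commuting_perturbation[OF Ps commute Phi_commute])
    thus ?thesis
      by (simp add: W_def Kop_def X_def PiP_idem[OF Ps] linear_diff[OF linear_PiP]
          linear_diff[OF bounded_linear.linear[OF Hess_bounded_linear]])
  qed
  have "negl Fil dst (\<lambda>P. (- PI (dH P - Hess E Ps (P - Ps)) + - PI (Hess E Ps ((P - Ps) - X P))) + - comm Ps (comm (D P) (dH P)))"
    using negl_linear[OF bounded_linear_compose[OF bounded_linear_minus[OF bounded_linear_ident] PI_bounded_linear] negl_Hgrad]
      negl_linear[OF bounded_linear_compose[OF bounded_linear_compose[OF bounded_linear_minus[OF bounded_linear_ident] PI_bounded_linear] Hess_bounded_linear] negl_projection]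
      negl_linear[OF bounded_linear_minus[OF bounded_linear_ident] quad]
    by (intro negl_add) (simp_all add: dH_def X_def)
  hence W: "negl Fil dst W" by (simp add: W_eq[abs_def])
  have "negl Fil dst V"
  proof (rule negl_bound[OF W])
    show "\<forall>\<^sub>F P in Fil. norm (V P) \<le> (1 / nu) * norm (W P)"
      using MN_Fil
    proof eventually_elim
      case (elim P)
      have XT: "X P \<in> T" unfolding X_def by (rule PiP_in_tangent[OF Ps MN_diff_symm[OF elim Ps]])
      have "PI (D P) \<in> T" unfolding D_def by (rule PiP_in_tangent[OF Ps MN_diff_symm[OF Phi_in_MN Ps]])
      hence "V P \<in> T" unfolding V_def by (intro tangent_add tangent_diff J_in_T XT)
      moreover have "Om (V P) = W P"
        by (simp add: V_def W_def linear_add[OF linear_Omega] linear_diff[OF linear_Omega] Omega_J)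
      ultimately show ?case using norm_le_Omega by fastforce
    qed
  qed simp
  moreover have "negl Fil dst (\<lambda>P. D P - PI (D P))"
  proof (rule negl_quadratic[OF dst_tendsto])
    show "\<forall>\<^sub>F P in Fil. norm (D P - PI (D P)) \<le> (1 + 2 * sqrt N) * c2\<^sup>2 * (dst P)\<^sup>2"
      using c2(2)
    proof eventually_elim
      case (elim P)
      have "norm (D P - PI (D P)) \<le> (1 + 2 * sqrt N) * (norm (D P))\<^sup>2"
        unfolding D_def by (rule MN_diff_normal_bound[OF Ps Phi_in_MN])
      also have "\<dots> \<le> (1 + 2 * sqrt N) * (c2 * dst P)\<^sup>2"
        using elim by (intro mult_left_mono power_mono) auto
      finally show ?case by (simp add: power_mult_distrib mult.assoc)
    qed
  qed simp
  ultimately have "negl Fil dst (\<lambda>P. (V P + (D P - PI (D P))) + - ((P - Ps) - PI (P - Ps)))"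
    using negl_linear[OF bounded_linear_minus[OF bounded_linear_ident] negl_projection]
    by (intro negl_add) simp_all
  thus ?thesis by (rule negl_cong) (simp add: V_def D_def X_def)
qed

definition G :: "real^'n^'n \<Rightarrow> real^'n^'n" where
  "G P = PiP P (Phi E N P - P)"

lemma negl_G: "negl Fil dst (\<lambda>P. G P + J (PI (P - Ps)))"
proof -
  obtain c where c: "c \<ge> 0" "\<forall>\<^sub>F P in Fil. norm (Phi E N P - Ps) \<le> c * dst P"
    using Phi_bound by blast
  have "negl Fil dst (\<lambda>P. (Phi E N P - P) - G P)"
  proof (rule negl_quadratic[OF dst_tendsto])
    show "\<forall>\<^sub>F P in Fil. norm ((Phi E N P - P) - G P) \<le> (1 + 2 * sqrt N) * (c + 1)\<^sup>2 * (dst P)\<^sup>2"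
      using c(2) MN_Fil
    proof eventually_elim
      case (elim P)
      have "norm (Phi E N P - P) \<le> (c + 1) * dst P"
        using elim(1) norm_triangle_ineq4[of "Phi E N P - Ps" "P - Ps"] by (simp add: algebra_simps)
      hence sq: "(norm (Phi E N P - P))\<^sup>2 \<le> (c + 1)\<^sup>2 * (dst P)\<^sup>2"
        by (metis norm_ge_zero power_mono power_mult_distrib)
      have "norm ((Phi E N P - P) - G P) \<le> (1 + 2 * sqrt N) * (norm (Phi E N P - P))\<^sup>2"
        unfolding G_def by (rule MN_diff_normal_bound[OF elim(2) Phi_in_MN])
      also have "\<dots> \<le> (1 + 2 * sqrt N) * ((c + 1)\<^sup>2 * (dst P)\<^sup>2)"
        using sq by (intro mult_left_mono) auto
      finally show ?case by (simp add: mult.assoc)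
    qed
  qed simp
  hence "negl Fil dst (\<lambda>P. (Phi E N P - P + J (PI (P - Ps))) + - ((Phi E N P - P) - G P))"
    by (intro negl_add[OF negl_Phi] negl_linear[OF bounded_linear_minus[OF bounded_linear_ident]]) auto
  thus ?thesis by (rule negl_cong) simp
qed

lemma J_PI_bounded_linear: "bounded_linear (\<lambda>X. J (PI X))"
  using linear_compose[OF linear_PiP linear_J] by (simp add: o_def linear_conv_bounded_linear)

lemma G_bound: "\<exists>c\<ge>0. \<forall>\<^sub>F P in Fil. norm (G P) \<le> c * dst P"
proof -
  obtain M where M: "M > 0" "\<And>X. norm (J (PI X)) \<le> norm X * M"
    using bounded_linear.pos_bounded[OF J_PI_bounded_linear] by blast
  have "\<forall>\<^sub>F P in Fil. norm (G P) \<le> (M + 1) * dst P"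
    using negl_imp_bound[OF negl_G]
  proof eventually_elim
    case (elim P)
    show ?case
      using elim M(2)[of "P - Ps"] norm_triangle_ineq4[of "G P + J (PI (P - Ps))" "J (PI (P - Ps))"]
      by (simp add: algebra_simps)
  qed
  thus ?thesis using M(1) by (intro exI[of _ "M + 1"]) auto
qed

lemma negl_F:
  shows "\<forall>\<^sub>F P in Fil. F beta P \<in> MN N"
    and "negl Fil dst (\<lambda>P. F beta P - Ps - (PI (P - Ps) - beta *\<^sub>R J (PI (P - Ps))))"
proof -
  obtain c where c: "c \<ge> 0" "\<forall>\<^sub>F P in Fil. norm (G P) \<le> c * dst P" using G_bound by blast
  have "((\<lambda>P. \<bar>beta\<bar> * (c * dst P)) \<longlongrightarrow> \<bar>beta\<bar> * (c * 0)) Fil"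
    by (intro tendsto_mult tendsto_const dst_tendsto)
  hence "\<forall>\<^sub>F P in Fil. \<bar>beta\<bar> * (c * dst P) < d" using d by (intro order_tendstoD(2)) auto
  hence main: "\<forall>\<^sub>F P in Fil. F beta P \<in> MN N \<and>
      norm (F beta P - P - beta *\<^sub>R G P) \<le> \<bar>C\<bar> * (beta\<^sup>2 * c\<^sup>2) * (dst P)\<^sup>2"
    using c(2) MN_Fil
  proof eventually_elim
    case (elim P)
    have n: "norm (beta *\<^sub>R G P) \<le> \<bar>beta\<bar> * (c * dst P)" using elim(2) by (simp add: mult_left_mono)
    have s: "symm (beta *\<^sub>R G P)"
      unfolding G_def by (intro symm_scaleR symm_PiP MN_symm[OF elim(3)] MN_diff_symm Phi_in_MN elim(3))
    have pi: "PiP P (beta *\<^sub>R G P) = beta *\<^sub>R G P"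
      by (simp add: G_def linear_cmul[OF linear_PiP] PiP_idem[OF elim(3)])
    from retraction[OF elim(3) s] n elim(1) have r: "F beta P \<in> MN N"
      "norm (F beta P - P - beta *\<^sub>R G P) \<le> C * (norm (beta *\<^sub>R G P))\<^sup>2"
      unfolding pi unfolding F_def G_def[symmetric] by auto
    note r(2)
    also have "C * (norm (beta *\<^sub>R G P))\<^sup>2 \<le> \<bar>C\<bar> * (\<bar>beta\<bar> * (c * dst P))\<^sup>2"
      using n by (intro mult_mono power_mono) auto
    finally show ?case using r(1) by (simp add: power_mult_distrib mult_ac)
  qed
  thus "\<forall>\<^sub>F P in Fil. F beta P \<in> MN N" by eventually_elim simp
  have "negl Fil dst (\<lambda>P. F beta P - P - beta *\<^sub>R G P)"
    by (rule negl_quadratic[OF dst_tendsto eventually_mono[OF main]]) auto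
  \<comment> \<open>Retraction error, error of the search direction and normal part of
    \<open>P - Ps\<close> add up to the error of the iteration map.\<close>
  hence "negl Fil dst (\<lambda>P. (F beta P - P - beta *\<^sub>R G P) + beta *\<^sub>R (G P + J (PI (P - Ps)))
      + ((P - Ps) - PI (P - Ps)))"
    using negl_linear[OF bounded_linear_scaleR_right negl_G]
    by (intro negl_add[OF negl_add negl_projection]) simp_all
  thus "negl Fil dst (\<lambda>P. F beta P - Ps - (PI (P - Ps) - beta *\<^sub>R J (PI (P - Ps))))"
    by (rule negl_cong) (simp add: scaleR_add_right)
qed

text \<open>\<open>B\<close> is blind to the normal part of \<open>P - Ps\<close>, which is small
  but not zero. Adding its Frobenius norm gives a quantity comparable to
  \<open>norm (P - Ps)\<close> in which the linear part still contracts by the spectral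
  radius.\<close>

definition err :: "real^'n^'n \<Rightarrow> real" where
  "err P = sqrt (B (PI (P - Ps)) (PI (P - Ps))) + norm ((P - Ps) - PI (P - Ps))"

text \<open>The upper bound covers all symmetric matrices because it is also applied to the
  remainder of the iteration map, which is not a difference of projectors.\<close>

lemma err_bounds: "\<exists>c1>0. \<exists>c2>0. (\<forall>P\<in>MN N. c1 * norm (P - Ps) \<le> err P) \<and>
   (\<forall>Z. symm Z \<longrightarrow> sqrt (B (PI Z) (PI Z)) + norm (Z - PI Z) \<le> c2 * norm Z)"
proof -
  obtain M where M: "M > 0" "\<And>X. norm (Om X) \<le> norm X * M"
    using bounded_linear.pos_bounded[of Om] linear_Omega linear_conv_bounded_linear by blast
  obtain L where L: "L > 0" "\<And>X. norm (PI X) \<le> norm X * L"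
    using bounded_linear.pos_bounded[OF PI_bounded_linear] by blast
  show ?thesis
  proof (rule exI[of _ "min (sqrt nu) 1"], rule conjI[OF _ exI[of _ "sqrt M * L + 1 + L"]],
      goal_cases pos bounds)
    case pos
    show "min (sqrt nu) 1 > 0" using nu by simp
  next
    case bounds
    show ?case
    proof (intro conjI ballI allI impI)
      show "sqrt M * L + 1 + L > 0" using M(1) L(1) by (intro add_pos_pos mult_pos_pos) auto
      fix P :: "real^'n^'n" assume P: "P \<in> MN N"
      define X where "X = PI (P - Ps)"
      have XT: "X \<in> T" unfolding X_def by (rule PiP_in_tangent[OF Ps MN_diff_symm[OF P Ps]])
      have "sqrt (nu * (norm X)\<^sup>2) \<le> sqrt (B X X)" using Omega_coercive[OF XT] by simp
      hence "sqrt nu * norm X \<le> sqrt (B X X)" by (simp add: real_sqrt_mult)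
      moreover have "min (sqrt nu) 1 * norm X \<le> sqrt nu * norm X" by (intro mult_right_mono) auto
      moreover have "min (sqrt nu) 1 * norm ((P - Ps) - X) \<le> 1 * norm ((P - Ps) - X)"
        by (intro mult_right_mono) auto
      moreover have "min (sqrt nu) 1 * norm (P - Ps) \<le> min (sqrt nu) 1 * (norm X + norm ((P - Ps) - X))"
        using norm_triangle_ineq[of X "(P - Ps) - X"] nu by (intro mult_left_mono) auto
      ultimately show "min (sqrt nu) 1 * norm (P - Ps) \<le> err P"
        unfolding err_def X_def[symmetric] by (simp add: distrib_left)
    next
      fix Z :: "real^'n^'n"
      have "B (PI Z) (PI Z) \<le> norm (PI Z) * (norm (PI Z) * M)"
        using norm_cauchy_schwarz[of "PI Z" "Om (PI Z)"] mult_left_mono[OF M(2)[of "PI Z"] norm_ge_zero[of "PI Z"]]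
        by linarith
      hence "B (PI Z) (PI Z) \<le> M * (norm (PI Z))\<^sup>2" by (simp add: power2_eq_square mult_ac)
      hence "sqrt (B (PI Z) (PI Z)) \<le> sqrt (M * (norm (PI Z))\<^sup>2)" by simp
      also have "\<dots> = sqrt M * norm (PI Z)" by (simp add: real_sqrt_mult)
      also have "\<dots> \<le> sqrt M * (norm Z * L)" using L(2) M(1) by (intro mult_left_mono) auto
      finally have 1: "sqrt (B (PI Z) (PI Z)) \<le> sqrt M * (norm Z * L)" .
      have "norm (Z - PI Z) \<le> norm Z + norm Z * L" using norm_triangle_ineq4[of Z "PI Z"] L(2)[of Z] by linarith
      with 1 show "sqrt (B (PI Z) (PI Z)) + norm (Z - PI Z) \<le> (sqrt M * L + 1 + L) * norm Z"
        by (simp add: algebra_simps)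
    qed
  qed
qed

lemma local_convergence:
  fixes beta
  defines "r \<equiv> op_spectral_radius T (\<lambda>X. X - beta *\<^sub>R J X)"
  assumes r1: "r < 1"
  shows "\<exists>delta>0. \<forall>theta>0. \<exists>C>0. \<forall>P0\<in>MN N. norm (P0 - Ps) < delta \<longrightarrow>
              (\<forall>k. iter R E N beta P0 k \<in> MN N \<and>
                   aufbau_gap (Hgrad E (iter R E N beta P0 k)) N \<and>
                   norm (iter R E N beta P0 k - Ps) \<le> C * (r + theta) ^ k * norm (P0 - Ps))"
proof -
  let ?L = "\<lambda>X. X - beta *\<^sub>R J X"
  interpret L: selfadjoint_on B T ?L by (rule selfadjoint)
  obtain c1 c2 where c: "c1 > 0" "c2 > 0" and lo: "\<And>P. P \<in> MN N \<Longrightarrow> c1 * norm (P - Ps) \<le> err P"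
    and up: "\<And>Z. symm Z \<Longrightarrow> sqrt (B (PI Z) (PI Z)) + norm (Z - PI Z) \<le> c2 * norm Z"
    using err_bounds by blast
  obtain g where g: "g > 0" "\<And>P. norm (P - Ps) < g \<Longrightarrow> aufbau_gap (Hgrad E P) N"
    using aufbau_gap_near by blast
  have r0: "r \<ge> 0" unfolding r_def using L.spectral_radius(1)[OF T_nontrivial] by auto
  have step: "\<exists>\<delta>>0. \<forall>P\<in>MN N. norm (P - Ps) < \<delta> \<longrightarrow> F beta P \<in> MN N \<and> err (F beta P) \<le> (r + eps) * err P"
    if eps: "eps > 0" for eps
  proof -
    \<comment> \<open>Scaled so that, after passing between norm and \<open>err\<close>, the
      remainder costs at most \<open>eps * err P\<close>.\<close>
    have "\<forall>\<^sub>F P in Fil. norm (F beta P - Ps - ?L (PI (P - Ps))) \<le> (eps * c1 / c2) * dst P"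
      using negl_F(2)[of beta] eps c unfolding negl_def by (auto dest!: spec[of _ "eps * c1 / c2"])
    hence "\<forall>\<^sub>F P in Fil. F beta P \<in> MN N \<and> err (F beta P) \<le> (r + eps) * err P"
      using negl_F(1)[of beta] MN_Fil
    proof eventually_elim
      case (elim P)
      define X where "X = PI (P - Ps)"
      define Z where "Z = F beta P - Ps - ?L X"
      have XT: "X \<in> T" unfolding X_def by (rule PiP_in_tangent[OF Ps MN_diff_symm[OF elim(3) Ps]])
      note LT = L.LT[OF XT]
      have sZ: "symm Z" unfolding Z_def by (intro symm_diff[of "_ - _"] MN_diff_symm elim(2) Ps tangentD(1)[OF Ps LT])
      have D: "F beta P - Ps = ?L X + Z" by (simp add: Z_def)
      have PD: "PI (F beta P - Ps) = ?L X + PI Z"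
        unfolding D linear_add[OF linear_PiP] tangentD(4)[OF Ps LT] ..
      \<comment> \<open>\<open>?L X\<close> is tangent, so the normal part of the new error comes
        from the remainder \<open>Z\<close> alone.\<close>
      have ND: "F beta P - Ps - PI (F beta P - Ps) = Z - PI Z" unfolding PD by (simp add: D)
      have "sqrt (B (?L X) (?L X)) \<le> sqrt (r\<^sup>2 * B X X)"
        unfolding r_def using L.spectral_radius(2)[OF T_nontrivial XT] by simp
      hence 1: "sqrt (B (?L X) (?L X)) \<le> r * sqrt (B X X)" using r0 by (simp add: real_sqrt_mult)
      have "err (F beta P) \<le> r * sqrt (B X X) + (sqrt (B (PI Z) (PI Z)) + norm (Z - PI Z))"
        unfolding err_def ND unfolding PD
        using L.form_triangle[OF LT PiP_in_tangent[OF Ps sZ]] 1 by linarith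
      also have "\<dots> \<le> r * err P + c2 * ((eps * c1 / c2) * dst P)"
      proof (intro add_mono)
        show "r * sqrt (B X X) \<le> r * err P" using r0 by (intro mult_left_mono) (simp_all add: err_def X_def)
        have "c2 * norm Z \<le> c2 * ((eps * c1 / c2) * dst P)"
          using elim(1) c(2) by (intro mult_left_mono) (simp_all add: Z_def X_def)
        thus "sqrt (B (PI Z) (PI Z)) + norm (Z - PI Z) \<le> c2 * ((eps * c1 / c2) * dst P)"
          using up[OF sZ] by linarith
      qed
      also have "c2 * ((eps * c1 / c2) * dst P) = eps * (c1 * dst P)" using c by simp
      also have "r * err P + eps * (c1 * dst P) \<le> r * err P + eps * err P"
        using lo[OF elim(3)] eps by (intro add_left_mono mult_left_mono) auto
      finally show ?case using elim(2) by (simp add: algebra_simps)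
    qed
    thus ?thesis unfolding eventually_Fil .
  qed
  have up': "err P \<le> c2 * norm (P - Ps)" if "P \<in> MN N" for P
    unfolding err_def by (rule up[OF MN_diff_symm[OF that Ps]])
  from local_linear_convergence[OF c lo up' r0 r1 step g(1)]
  obtain delta where delta: "delta > 0" and conv: "\<forall>theta>0. \<exists>C>0. \<forall>P0\<in>MN N. norm (P0 - Ps) < delta \<longrightarrow>
      (\<forall>k. (F beta ^^ k) P0 \<in> MN N \<and> norm ((F beta ^^ k) P0 - Ps) < g \<and>
        norm ((F beta ^^ k) P0 - Ps) \<le> C * (r + theta) ^ k * norm (P0 - Ps))"
    by auto
  show ?thesis
    unfolding iter_eq_funpow
  proof (rule exI[of _ delta], intro conjI allI impI delta)
    fix theta :: real assume "theta > 0"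
    with conv obtain C where C: "C > 0" "\<forall>P0\<in>MN N. norm (P0 - Ps) < delta \<longrightarrow>
      (\<forall>k. (F beta ^^ k) P0 \<in> MN N \<and> norm ((F beta ^^ k) P0 - Ps) < g \<and>
        norm ((F beta ^^ k) P0 - Ps) \<le> C * (r + theta) ^ k * norm (P0 - Ps))" by auto
    show "\<exists>C>0. \<forall>P0\<in>MN N. norm (P0 - Ps) < delta \<longrightarrow>
      (\<forall>k. (F beta ^^ k) P0 \<in> MN N \<and> aufbau_gap (Hgrad E ((F beta ^^ k) P0)) N \<and>
        norm ((F beta ^^ k) P0 - Ps) \<le> C * (r + theta) ^ k * norm (P0 - Ps))"
      using C g(2) by (intro exI[of _ C]) auto
  qed
qed

end

theorem theorem3p3:
  fixes E :: "real^'n^'n \<Rightarrow> real"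
    and R :: "real^'n^'n \<Rightarrow> real^'n^'n"
    and N :: nat and Ps :: "real^'n^'n"
  assumes N_range: "1 \<le> N" "N \<le> CARD('n)"
    and E_C2: "C2 E"
    and Ps_in: "Ps \<in> MN N"
    and nondeg_min: "\<exists>eta>0. \<exists>r>0. \<forall>P\<in>MN N. norm (P - Ps) < r \<longrightarrow>
                       E P \<ge> E Ps + eta * (norm (P - Ps))\<^sup>2"
    and R_C2: "C2 R"
    and retraction: "\<exists>d>0. \<exists>C. \<forall>P\<in>MN N. \<forall>X. symm X \<and> norm X < d \<longrightarrow>
                       R (P + X) \<in> MN N \<and>
                       norm (R (P + X) - P - PiP P X) \<le> C * (norm X)\<^sup>2"
    and aufbau_fix: "Phi E N Ps = Ps"
    and aufbau_gap: "aufbau_gap (Hgrad E Ps) N"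
  shows "\<exists>beta0>0. \<forall>beta. 0 < beta \<and> beta < beta0 \<longrightarrow>
           op_spectral_radius (tangent Ps) (\<lambda>X. X - beta *\<^sub>R J_SCF E Ps X) < 1 \<and>
           (\<exists>delta>0. \<forall>theta>0. \<exists>C>0. \<forall>P0\<in>MN N. norm (P0 - Ps) < delta \<longrightarrow>
              (\<forall>k. iter R E N beta P0 k \<in> MN N \<and>
                   aufbau_gap (Hgrad E (iter R E N beta P0 k)) N \<and>
                   norm (iter R E N beta P0 k - Ps) \<le>
                     C * (op_spectral_radius (tangent Ps) (\<lambda>X. X - beta *\<^sub>R J_SCF E Ps X) + theta) ^ k
                       * norm (P0 - Ps)))"
proof -
  obtain phi lam where N: "1 \<le> N" "N < CARD('n)" and ed: "eigdec (Hgrad E Ps) phi lam"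
    and lt: "lam (N - 1) < lam N"
    using aufbau_gap unfolding aufbau_gap_def by blast
  \<comment> \<open>The eigenbasis behind \<open>Phi\<close> may differ from the one exhibiting the
    gap; the stability bound with two equal matrices shows that both give the same
    projector.\<close>
  obtain psi mu where ed': "eigdec (Hgrad E Ps) psi mu" and Ps: "PhiA (Hgrad E Ps) N = eigproj psi N"
    by (rule PhiA_eigproj[OF symm_Hgrad])
  define nu where "nu = lam N - lam (N - 1)"
  have nu: "nu > 0" using lt by (simp add: nu_def)
  have gap: "nu / 2 * (norm (Q - eigproj phi N))\<^sup>2 \<le> inner (Hgrad E Ps) (Q - eigproj phi N)"
    if "Q \<in> MN N" for Q
    using eigproj_gap[OF ed N that] by (simp add: nu_def)
  have "norm (eigproj psi N - eigproj phi N) \<le> 2 / nu * norm (Hgrad E Ps - Hgrad E Ps)"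
    using N by (intro eigproj_Lipschitz[OF ed' N _ nu gap] eigproj_in_MN(1)[OF ed]) auto
  hence Ps_eq: "eigproj phi N = Ps" using Ps aufbau_fix by (simp add: Phi_def)
  obtain eta r where er: "eta > 0" "r > 0" "\<forall>P\<in>MN N. norm (P - Ps) < r \<longrightarrow> E P \<ge> E Ps + eta * (norm (P - Ps))\<^sup>2"
    using nondeg_min by blast
  obtain d C where dC: "d > 0" "\<forall>P\<in>MN N. \<forall>X. symm X \<and> norm X < d \<longrightarrow>
     R (P + X) \<in> MN N \<and> norm (R (P + X) - P - PiP P X) \<le> C * (norm X)\<^sup>2"
    using retraction by blast
  interpret scf E R N Ps nu eta r d C
  proof (rule scf.intro)
    show "Hgrad E Ps ** Ps = Ps ** Hgrad E Ps"
      using eigproj_in_MN(2)[OF ed, of N] N by (simp add: Ps_eq)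
  qed (use N E_C2 Ps_in nu gap er dC in \<open>auto simp: Ps_eq\<close>)
  obtain beta0 where "beta0 > 0" and beta0: "\<And>beta. 0 < beta \<Longrightarrow> beta < beta0 \<Longrightarrow>
      op_spectral_radius (tangent Ps) (\<lambda>X. X - beta *\<^sub>R J_SCF E Ps X) < 1"
    using spectral_radius_less_1 by blast
  show ?thesis
  proof (rule exI[of _ beta0], intro conjI allI impI \<open>beta0 > 0\<close>)
    fix beta assume "0 < beta \<and> beta < beta0"
    hence r: "op_spectral_radius (tangent Ps) (\<lambda>X. X - beta *\<^sub>R J_SCF E Ps X) < 1" using beta0 by blast
    show "op_spectral_radius (tangent Ps) (\<lambda>X. X - beta *\<^sub>R J_SCF E Ps X) < 1" by (rule r)
    show "\<exists>delta>0. \<forall>theta>0. \<exists>C>0. \<forall>P0\<in>MN N. norm (P0 - Ps) < delta \<longrightarrow>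
              (\<forall>k. iter R E N beta P0 k \<in> MN N \<and>
                   aufbau_gap (Hgrad E (iter R E N beta P0 k)) N \<and>
                   norm (iter R E N beta P0 k - Ps) \<le>
                     C * (op_spectral_radius (tangent Ps) (\<lambda>X. X - beta *\<^sub>R J_SCF E Ps X) + theta) ^ k
                       * norm (P0 - Ps))"
      by (rule local_convergence[OF r])
  qed
qed

end
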